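(* Let $\mathfrak g$ be a three-dimensional non-unimodular real Lie algebra and $(H,g,\delta=0)$ a divergence-free generalized Einstein structure on $\mathfrak g$. Then $H=0$, $g$ is indefinite and non-degenerate on the unimodular kernel $\mathfrak u=\ker\tau$, $\tau=\mathrm{tr}\circ\mathrm{ad}$, and $\mathfrak g$ is isomorphic to $\mathbb R\ltimes_A\mathbb R^2$ with $A=\begin{pmatrix}1&1\\-1&1\end{pmatrix}$. More precisely, $g$ belongs to the following one-parameter family: there exist a $g$-orthonormal basis $(v_1,v_2,v_3)$ of $\mathfrak g$ with $v_1,v_3\in\mathfrak u$ and $g(v_1,v_1)=g(v_2,v_2)=-g(v_3,v_3)$, and a constant $\theta>0$, such that $$[v_1,v_3]=0,\qquad [v_2,v_1]=\theta v_1-\theta v_3,\qquad [v_2,v_3]=\theta v_1+\theta v_3 .$$ The metric $g$ is a Ricci soliton which is not of constant curvature.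
   Context: $\mathbb R\ltimes_A\mathbb R^2$ is the semidirect product Lie algebra in which the generator of $\mathbb R$ acts on the abelian ideal $\mathbb R^2$ by $A$. A Lie algebra is unimodular if $\mathrm{tr}\,\mathrm{ad}_X=0$ for all $X$. A non-degenerate symmetric bilinear form $g$ on $\mathfrak g$ is identified with a left-invariant pseudo-Riemannian metric on a Lie group $G$ with Lie algebra $\mathfrak g$; curvature statements refer to the latter. A Ricci soliton is a pseudo-Riemannian metric $g$ satisfying $Ric^g+\frac12\mathcal L_Xg=cg$ for some vector field $X$ and some constant $c\in\mathbb R$. Let $E=\mathfrak g\oplus\mathfrak g^*$, with scalar product $\langle X+\xi,Y+\eta\rangle=\frac12(\xi(Y)+\eta(X))$. For $H\in\bigwedge^3\mathfrak g^*$ (automatically closed when $\dim\mathfrak g=3$) the Dorfman bracket is $[X+\xi,Y+\eta]_H=[X,Y]-\mathrm{ad}_X^*\eta+\mathrm{ad}_Y^*\xi+H(X,Y,\cdot)$, where $\mathrm{ad}_X^*\eta=\eta\circ\mathrm{ad}_X$. Put $gX=g(X,\cdot)$ and $E_\pm=\{X\pm gX:X\in\mathfrak g\}$. A left-invariant generalized connection is a linear map $D:E\to\mathfrak{so}(E)$, $u\mapsto D_u$. Its torsion is $T(u,v)=D_uv-D_vu-[u,v]_H+(Du)^*v$, where $Du$ is $w\mapsto D_wu$ and $*$ is the adjoint for $\langle\cdot,\cdot\rangle$. $D$ is Levi-Civita if $T=0$ and $D_uE_\pm\subset E_\pm$ for all $u$. Its divergence is $\delta_D(v)=\mathrm{tr}(u\mapsto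 D_uv)$. Given $\delta\in E^*$, choose a Levi-Civita $D$ with $\delta_D=\delta$ (one exists), put $R(u,v)w=D_uD_vw-D_vD_uw-D_{[u,v]_H}w$ and, for $u_\pm\in E_\pm$, $Ric^+_\delta(u_-,u_+)=\mathrm{tr}(E_+\ni w\mapsto R(w,u_-)u_+\in E_+)$, $Ric^-_\delta(u_+,u_-)=\mathrm{tr}(E_-\ni w\mapsto R(w,u_+)u_-\in E_-)$; these are known to be independent of the choice of $D$. A generalized Einstein structure on $\mathfrak g$ is a triple $(H,g,\delta)$ with $H\in\bigwedge^3\mathfrak g^*$, $g\in\mathrm{Sym}^2\mathfrak g^*$ non-degenerate and $\delta\in E^*$ such that $Ric^+_\delta=0$ and $Ric^-_\delta=0$. It is divergence-free if $\delta=0$. *)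

theory Defs
  imports "HOL-Analysis.Analysis" "HOL-Algebra.Group"
begin

section \<open>Linear algebra\<close>

text \<open>Trace of an endomorphism \<open>f\<close> of the finite-dimensional subspace \<open>S\<close>; the value does not
  depend on the chosen basis.\<close>

definition trace_on :: "'v::real_vector set \<Rightarrow> ('v \<Rightarrow> 'v) \<Rightarrow> real" where
  "trace_on S f =
     (let B = (SOME B. independent B \<and> span B = S) in \<Sum>b\<in>B. representation B (f b) b)"

definition nondegenerate_on :: "'v set \<Rightarrow> ('v::real_vector \<Rightarrow> 'v \<Rightarrow> real) \<Rightarrow> bool" where
  "nondegenerate_on S g \<longleftrightarrow> (\<forall>x\<in>S. (\<forall>y\<in>S. g x y = 0) \<longrightarrow> x = 0)"

definition indefinite_on :: "'v set \<Rightarrow> ('v::real_vector \<Rightarrow> 'v \<Rightarrow> real) \<Rightarrow> bool" where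
  "indefinite_on S g \<longleftrightarrow> (\<exists>x\<in>S. g x x > 0) \<and> (\<exists>y\<in>S. g y y < 0)"

definition scalar_product :: "('v::real_normed_vector \<Rightarrow> 'v \<Rightarrow> real) \<Rightarrow> bool" where
  "scalar_product g \<longleftrightarrow> bilinear g \<and> (\<forall>x y. g x y = g y x) \<and> nondegenerate_on UNIV g"

definition three_form :: "('v::real_vector \<Rightarrow> 'v \<Rightarrow> 'v \<Rightarrow> real) \<Rightarrow> bool" where
  "three_form H \<longleftrightarrow>
     (\<forall>y z. linear (\<lambda>x. H x y z)) \<and> (\<forall>x z. linear (\<lambda>y. H x y z)) \<and> (\<forall>x y. linear (H x y)) \<and>
     (\<forall>x y. H x x y = 0 \<and> H x y y = 0 \<and> H x y x = 0)"


section \<open>Lie algebras\<close>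

text \<open>A finite-dimensional real Lie algebra is given by a bracket on a type of class
  \<open>euclidean_space\<close>.  The inner product carried by that class plays no role.\<close>

definition lie_algebra :: "('v::real_vector \<Rightarrow> 'v \<Rightarrow> 'v) \<Rightarrow> bool" where
  "lie_algebra br \<longleftrightarrow>
     bilinear br \<and> (\<forall>x. br x x = 0) \<and>
     (\<forall>x y z. br x (br y z) + br y (br z x) + br z (br x y) = 0)"

definition lie_isomorphic ::
    "('v::real_vector \<Rightarrow> 'v \<Rightarrow> 'v) \<Rightarrow> ('w::real_vector \<Rightarrow> 'w \<Rightarrow> 'w) \<Rightarrow> bool" where
  "lie_isomorphic br br' \<longleftrightarrow> (\<exists>f. linear f \<and> bij f \<and> (\<forall>x y. f (br x y) = br' (f x) (f y)))"

definition trace_ad :: "('v::real_vector \<Rightarrow> 'v \<Rightarrow> 'v) \<Rightarrow> 'v \<Rightarrow> real" where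
  "trace_ad br x = trace_on UNIV (br x)"

definition unimodular :: "('v::real_vector \<Rightarrow> 'v \<Rightarrow> 'v) \<Rightarrow> bool" where
  "unimodular br \<longleftrightarrow> (\<forall>x. trace_ad br x = 0)"

definition unimodular_kernel :: "('v::real_vector \<Rightarrow> 'v \<Rightarrow> 'v) \<Rightarrow> 'v set" where
  "unimodular_kernel br = {x. trace_ad br x = 0}"

text \<open>The bracket of the semidirect product of \<open>\<real>\<close> with the abelian ideal \<open>\<real>\<^sup>n\<close>, where
  \<open>(1, 0)\<close> acts by \<open>A\<close>.\<close>

definition semidirect_bracket ::
    "real^'n^'n \<Rightarrow> real \<times> (real^'n) \<Rightarrow> real \<times> (real^'n) \<Rightarrow> real \<times> (real^'n)" where
  "semidirect_bracket A u v = (0, fst u *\<^sub>R (A *v snd v) - fst v *\<^sub>R (A *v snd u))"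


section \<open>Generalized geometry on a Lie algebra\<close>

text \<open>The dual space of a Euclidean space \<open>'a\<close> is the type \<open>'a \<Rightarrow>\<^sub>L real\<close>.\<close>

type_synonym 'a gen = "'a \<times> ('a \<Rightarrow>\<^sub>L real)"

definition pairing :: "'a::euclidean_space gen \<Rightarrow> 'a gen \<Rightarrow> real" where
  "pairing u v = (blinfun_apply (snd u) (fst v) + blinfun_apply (snd v) (fst u)) / 2"

definition coad :: "('a::euclidean_space \<Rightarrow> 'a \<Rightarrow> 'a) \<Rightarrow> 'a \<Rightarrow> ('a \<Rightarrow>\<^sub>L real) \<Rightarrow> ('a \<Rightarrow>\<^sub>L real)" where
  "coad br x \<eta> = \<eta> o\<^sub>L Blinfun (br x)"

definition dorfman ::
    "('a::euclidean_space \<Rightarrow> 'a \<Rightarrow> 'a) \<Rightarrow> ('a \<Rightarrow> 'a \<Rightarrow> 'a \<Rightarrow> real) \<Rightarrow> 'a gen \<Rightarrow> 'a gen \<Rightarrow> 'a gen" where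
  "dorfman br H u v =
     (br (fst u) (fst v),
      - coad br (fst u) (snd v) + coad br (fst v) (snd u) + Blinfun (H (fst u) (fst v)))"

definition E_plus :: "('a::euclidean_space \<Rightarrow> 'a \<Rightarrow> real) \<Rightarrow> 'a gen set" where
  "E_plus g = range (\<lambda>x. (x, Blinfun (g x)))"

definition E_minus :: "('a::euclidean_space \<Rightarrow> 'a \<Rightarrow> real) \<Rightarrow> 'a gen set" where
  "E_minus g = range (\<lambda>x. (x, - Blinfun (g x)))"

definition gen_connection :: "('a::euclidean_space gen \<Rightarrow> 'a gen \<Rightarrow> 'a gen) \<Rightarrow> bool" where
  "gen_connection D \<longleftrightarrow>
     bilinear D \<and> (\<forall>u v w. pairing (D u v) w + pairing v (D u w) = 0)"

definition pairing_adjoint :: "('a::euclidean_space gen \<Rightarrow> 'a gen) \<Rightarrow> 'a gen \<Rightarrow> 'a gen" where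
  "pairing_adjoint f v = (THE z. \<forall>w. pairing z w = pairing v (f w))"

definition gen_torsion ::
    "('a::euclidean_space \<Rightarrow> 'a \<Rightarrow> 'a) \<Rightarrow> ('a \<Rightarrow> 'a \<Rightarrow> 'a \<Rightarrow> real) \<Rightarrow> ('a gen \<Rightarrow> 'a gen \<Rightarrow> 'a gen) \<Rightarrow>
     'a gen \<Rightarrow> 'a gen \<Rightarrow> 'a gen" where
  "gen_torsion br H D u v =
     D u v - D v u - dorfman br H u v + pairing_adjoint (\<lambda>w. D w u) v"

definition gen_levi_civita ::
    "('a::euclidean_space \<Rightarrow> 'a \<Rightarrow> 'a) \<Rightarrow> ('a \<Rightarrow> 'a \<Rightarrow> 'a \<Rightarrow> real) \<Rightarrow> ('a \<Rightarrow> 'a \<Rightarrow> real) \<Rightarrow>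
     ('a gen \<Rightarrow> 'a gen \<Rightarrow> 'a gen) \<Rightarrow> bool" where
  "gen_levi_civita br H g D \<longleftrightarrow>
     gen_connection D \<and> (\<forall>u v. gen_torsion br H D u v = 0) \<and>
     (\<forall>u. D u ` E_plus g \<subseteq> E_plus g \<and> D u ` E_minus g \<subseteq> E_minus g)"

definition gen_divergence :: "('a::euclidean_space gen \<Rightarrow> 'a gen \<Rightarrow> 'a gen) \<Rightarrow> 'a gen \<Rightarrow> real" where
  "gen_divergence D v = trace_on UNIV (\<lambda>u. D u v)"

definition gen_curvature ::
    "('a::euclidean_space \<Rightarrow> 'a \<Rightarrow> 'a) \<Rightarrow> ('a \<Rightarrow> 'a \<Rightarrow> 'a \<Rightarrow> real) \<Rightarrow> ('a gen \<Rightarrow> 'a gen \<Rightarrow> 'a gen) \<Rightarrow>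
     'a gen \<Rightarrow> 'a gen \<Rightarrow> 'a gen \<Rightarrow> 'a gen" where
  "gen_curvature br H D u v w = D u (D v w) - D v (D u w) - D (dorfman br H u v) w"

text \<open>For \<open>u\<close> in \<open>E_minus g\<close> and \<open>v\<close> in \<open>E_plus g\<close>, and vice versa, respectively.\<close>

definition gen_ric_plus ::
    "('a::euclidean_space \<Rightarrow> 'a \<Rightarrow> 'a) \<Rightarrow> ('a \<Rightarrow> 'a \<Rightarrow> 'a \<Rightarrow> real) \<Rightarrow> ('a \<Rightarrow> 'a \<Rightarrow> real) \<Rightarrow>
     ('a gen \<Rightarrow> 'a gen \<Rightarrow> 'a gen) \<Rightarrow> 'a gen \<Rightarrow> 'a gen \<Rightarrow> real" where
  "gen_ric_plus br H g D u v = trace_on (E_plus g) (\<lambda>w. gen_curvature br H D w u v)"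

definition gen_ric_minus ::
    "('a::euclidean_space \<Rightarrow> 'a \<Rightarrow> 'a) \<Rightarrow> ('a \<Rightarrow> 'a \<Rightarrow> 'a \<Rightarrow> real) \<Rightarrow> ('a \<Rightarrow> 'a \<Rightarrow> real) \<Rightarrow>
     ('a gen \<Rightarrow> 'a gen \<Rightarrow> 'a gen) \<Rightarrow> 'a gen \<Rightarrow> 'a gen \<Rightarrow> real" where
  "gen_ric_minus br H g D u v = trace_on (E_minus g) (\<lambda>w. gen_curvature br H D w u v)"

text \<open>A Levi-Civita generalized connection with prescribed divergence exists, and its Ricci
  curvatures do not depend on the choice; hence the existential quantifier over \<open>D\<close>.\<close>

definition generalized_einstein ::
    "('a::euclidean_space \<Rightarrow> 'a \<Rightarrow> 'a) \<Rightarrow> ('a \<Rightarrow> 'a \<Rightarrow> 'a \<Rightarrow> real) \<Rightarrow> ('a \<Rightarrow> 'a \<Rightarrow> real) \<Rightarrow>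
     ('a gen \<Rightarrow> real) \<Rightarrow> bool" where
  "generalized_einstein br H g \<delta> \<longleftrightarrow>
     three_form H \<and> scalar_product g \<and> linear \<delta> \<and>
     (\<exists>D. gen_levi_civita br H g D \<and> (\<forall>v. gen_divergence D v = \<delta> v) \<and>
        (\<forall>u\<in>E_minus g. \<forall>v\<in>E_plus g. gen_ric_plus br H g D u v = 0) \<and>
        (\<forall>u\<in>E_plus g. \<forall>v\<in>E_minus g. gen_ric_minus br H g D u v = 0))"


section \<open>Pseudo-Riemannian geometry in coordinates\<close>

fun Ck_on :: "nat \<Rightarrow> 'v::real_normed_vector set \<Rightarrow> ('v \<Rightarrow> 'w::real_normed_vector) \<Rightarrow> bool" where
  "Ck_on 0 S f \<longleftrightarrow> continuous_on S f"
| "Ck_on (Suc k) S f \<longleftrightarrow>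
     (\<forall>x\<in>S. f differentiable (at x)) \<and> (\<forall>v. Ck_on k S (\<lambda>x. frechet_derivative f (at x) v))"

definition smooth_on :: "'v::real_normed_vector set \<Rightarrow> ('v \<Rightarrow> 'w::real_normed_vector) \<Rightarrow> bool" where
  "smooth_on S f \<longleftrightarrow> open S \<and> (\<forall>k. Ck_on k S f)"

text \<open>In this section vector fields are maps \<open>'a \<Rightarrow> 'a\<close> and a metric \<open>\<gamma>\<close> assigns a bilinear form
  \<open>\<gamma> x\<close> to each point \<open>x\<close>; all operations at \<open>x\<close> depend only on germs at \<open>x\<close>.\<close>

definition field_bracket :: "('a::euclidean_space \<Rightarrow> 'a) \<Rightarrow> ('a \<Rightarrow> 'a) \<Rightarrow> 'a \<Rightarrow> 'a" where
  "field_bracket X Y x = frechet_derivative Y (at x) (X x) - frechet_derivative X (at x) (Y x)"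

definition christoffel :: "('a::euclidean_space \<Rightarrow> 'a \<Rightarrow> 'a \<Rightarrow> real) \<Rightarrow> 'a \<Rightarrow> 'a \<Rightarrow> 'a \<Rightarrow> 'a" where
  "christoffel \<gamma> x u v =
     (THE z. \<forall>w. 2 * \<gamma> x z w =
        frechet_derivative (\<lambda>y. \<gamma> y v w) (at x) u + frechet_derivative (\<lambda>y. \<gamma> y u w) (at x) v
        - frechet_derivative (\<lambda>y. \<gamma> y u v) (at x) w)"

definition covariant_derivative ::
    "('a::euclidean_space \<Rightarrow> 'a \<Rightarrow> 'a \<Rightarrow> real) \<Rightarrow> ('a \<Rightarrow> 'a) \<Rightarrow> ('a \<Rightarrow> 'a) \<Rightarrow> 'a \<Rightarrow> 'a" where
  "covariant_derivative \<gamma> X Y x =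
     frechet_derivative Y (at x) (X x) + christoffel \<gamma> x (X x) (Y x)"

definition riemann_op ::
    "('a::euclidean_space \<Rightarrow> 'a \<Rightarrow> 'a \<Rightarrow> real) \<Rightarrow> ('a \<Rightarrow> 'a) \<Rightarrow> ('a \<Rightarrow> 'a) \<Rightarrow> ('a \<Rightarrow> 'a) \<Rightarrow> 'a \<Rightarrow> 'a" where
  "riemann_op \<gamma> X Y Z x =
     covariant_derivative \<gamma> X (covariant_derivative \<gamma> Y Z) x
     - covariant_derivative \<gamma> Y (covariant_derivative \<gamma> X Z) x
     - covariant_derivative \<gamma> (field_bracket X Y) Z x"

text \<open>Tensors are evaluated on tangent vectors by extending these to constant fields.\<close>

definition riemann ::
    "('a::euclidean_space \<Rightarrow> 'a \<Rightarrow> 'a \<Rightarrow> real) \<Rightarrow> 'a \<Rightarrow> 'a \<Rightarrow> 'a \<Rightarrow> 'a \<Rightarrow> 'a" where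
  "riemann \<gamma> x u v w = riemann_op \<gamma> (\<lambda>_. u) (\<lambda>_. v) (\<lambda>_. w) x"

definition ricci :: "('a::euclidean_space \<Rightarrow> 'a \<Rightarrow> 'a \<Rightarrow> real) \<Rightarrow> 'a \<Rightarrow> 'a \<Rightarrow> 'a \<Rightarrow> real" where
  "ricci \<gamma> x v w = trace_on UNIV (\<lambda>u. riemann \<gamma> x u v w)"

definition lie_derivative_metric ::
    "('a::euclidean_space \<Rightarrow> 'a) \<Rightarrow> ('a \<Rightarrow> 'a \<Rightarrow> 'a \<Rightarrow> real) \<Rightarrow> 'a \<Rightarrow> 'a \<Rightarrow> 'a \<Rightarrow> real" where
  "lie_derivative_metric X \<gamma> x u v =
     frechet_derivative (\<lambda>y. \<gamma> y u v) (at x) (X x)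
     - \<gamma> x (field_bracket X (\<lambda>_. u) x) v - \<gamma> x u (field_bracket X (\<lambda>_. v) x)"


section \<open>Smooth manifolds and Lie groups\<close>

text \<open>A chart is a domain together with a coordinate map, which is relevant only on the domain.
  The manifold is the whole (Hausdorff, second countable) type \<open>'p\<close>.\<close>

type_synonym ('p, 'a) chart = "'p set \<times> ('p \<Rightarrow> 'a)"

definition chart_inv :: "('p, 'a) chart \<Rightarrow> 'a \<Rightarrow> 'p" where
  "chart_inv c = inv_into (fst c) (snd c)"

definition smooth_atlas ::
    "('p::{t2_space,second_countable_topology}, 'a::euclidean_space) chart set \<Rightarrow> bool" where
  "smooth_atlas A \<longleftrightarrow>
     \<Union> (fst ` A) = UNIV \<and>
     (\<forall>c\<in>A. open (fst c) \<and> open (snd c ` fst c) \<and>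
        homeomorphism (fst c) (snd c ` fst c) (snd c) (chart_inv c)) \<and>
     (\<forall>c\<in>A. \<forall>d\<in>A. smooth_on (snd c ` (fst c \<inter> fst d)) (snd d \<circ> chart_inv c))"

text \<open>Continuity of \<open>f\<close> is part of this definition, since \<open>smooth_on\<close> includes openness.\<close>

definition smooth_map ::
    "('p, 'a::real_normed_vector) chart set \<Rightarrow> ('q, 'b::real_normed_vector) chart set \<Rightarrow> ('p \<Rightarrow> 'q) \<Rightarrow> bool"
  where
  "smooth_map A B f \<longleftrightarrow>
     (\<forall>c\<in>A. \<forall>d\<in>B. smooth_on (snd c ` (fst c \<inter> f -` fst d)) (snd d \<circ> f \<circ> chart_inv c))"

definition product_atlas ::
    "('p, 'a) chart set \<Rightarrow> ('q, 'b) chart set \<Rightarrow> ('p \<times> 'q, 'a \<times> 'b) chart set" where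
  "product_atlas A B = {(fst c \<times> fst d, map_prod (snd c) (snd d)) | c d. c \<in> A \<and> d \<in> B}"

definition lie_group ::
    "'p monoid \<Rightarrow> ('p::{t2_space,second_countable_topology}, 'a::euclidean_space) chart set \<Rightarrow> bool"
  where
  "lie_group G A \<longleftrightarrow>
     group G \<and> carrier G = UNIV \<and> smooth_atlas A \<and>
     smooth_map (product_atlas A A) A (\<lambda>(p, q). p \<otimes>\<^bsub>G\<^esub> q) \<and>
     smooth_map A A (\<lambda>p. inv\<^bsub>G\<^esub> p)"

text \<open>Coordinate expression, in the charts \<open>c\<close> and \<open>d\<close>, of the differential of \<open>f\<close> at \<open>p\<close>.\<close>

definition tangent_map ::
    "('p, 'a::real_normed_vector) chart \<Rightarrow> ('q, 'b::real_normed_vector) chart \<Rightarrow> ('p \<Rightarrow> 'q) \<Rightarrow> 'p \<Rightarrow> 'a \<Rightarrow> 'b"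
  where
  "tangent_map c d f p = frechet_derivative (snd d \<circ> f \<circ> chart_inv c) (at (snd c p))"

text \<open>\<open>X c p\<close> is the coordinate vector, in the chart \<open>c\<close>, of the vector field \<open>X\<close> at \<open>p\<close>, and
  likewise for metrics \<open>\<gamma> c p\<close>.  Where \<open>c\<close> is not a chart around \<open>p\<close>, \<open>X c p\<close> is normalized
  to \<open>0\<close>, so that equality of vector fields is equality of functions.\<close>

type_synonym ('p, 'a) field = "('p, 'a) chart \<Rightarrow> 'p \<Rightarrow> 'a"
type_synonym ('p, 'a) metric_field = "('p, 'a) chart \<Rightarrow> 'p \<Rightarrow> 'a \<Rightarrow> 'a \<Rightarrow> real"

definition in_chart :: "('p, 'a) chart \<Rightarrow> (('p, 'a) chart \<Rightarrow> 'p \<Rightarrow> 'b) \<Rightarrow> 'a \<Rightarrow> 'b" where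
  "in_chart c X x = X c (chart_inv c x)"

definition smooth_vector_field ::
    "('p, 'a::euclidean_space) chart set \<Rightarrow> ('p, 'a) field \<Rightarrow> bool" where
  "smooth_vector_field A X \<longleftrightarrow>
     (\<forall>c p. \<not> (c \<in> A \<and> p \<in> fst c) \<longrightarrow> X c p = 0) \<and>
     (\<forall>c\<in>A. \<forall>d\<in>A. \<forall>p\<in>fst c \<inter> fst d. X d p = tangent_map c d id p (X c p)) \<and>
     (\<forall>c\<in>A. smooth_on (snd c ` fst c) (in_chart c X))"

definition left_invariant_fields ::
    "'p monoid \<Rightarrow> ('p, 'a::euclidean_space) chart set \<Rightarrow> ('p, 'a) field set" where
  "left_invariant_fields G A =
     {X. smooth_vector_field A X \<and>
         (\<forall>a p. \<forall>c\<in>A. \<forall>d\<in>A. p \<in> fst c \<and> a \<otimes>\<^bsub>G\<^esub> p \<in> fst d \<longrightarrow>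
            X d (a \<otimes>\<^bsub>G\<^esub> p) = tangent_map c d (\<lambda>q. a \<otimes>\<^bsub>G\<^esub> q) p (X c p))}"

text \<open>\<open>\<Lambda>\<close> is an isomorphism from the Lie algebra with bracket \<open>br\<close> onto the Lie algebra of
  left-invariant vector fields of \<open>G\<close>.\<close>

definition lie_algebra_of_group_iso ::
    "'p monoid \<Rightarrow> ('p, 'a::euclidean_space) chart set \<Rightarrow> ('a \<Rightarrow> 'a \<Rightarrow> 'a) \<Rightarrow> ('a \<Rightarrow> ('p, 'a) field) \<Rightarrow> bool"
  where
  "lie_algebra_of_group_iso G A br \<Lambda> \<longleftrightarrow>
     (\<forall>c p. linear (\<lambda>x. \<Lambda> x c p)) \<and> bij_betw \<Lambda> UNIV (left_invariant_fields G A) \<and>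
     (\<forall>x y. \<forall>c\<in>A. \<forall>q\<in>snd c ` fst c.
        in_chart c (\<Lambda> (br x y)) q = field_bracket (in_chart c (\<Lambda> x)) (in_chart c (\<Lambda> y)) q)"

text \<open>The metric on the group whose value on the left-invariant fields \<open>\<Lambda> x\<close>, \<open>\<Lambda> y\<close> is the
  constant \<open>g x y\<close>.\<close>

definition left_invariant_metric ::
    "('a \<Rightarrow> ('p, 'a) field) \<Rightarrow> ('a \<Rightarrow> 'a \<Rightarrow> real) \<Rightarrow> ('p, 'a::euclidean_space) metric_field" where
  "left_invariant_metric \<Lambda> g c p u v =
     g (inv_into UNIV (\<lambda>x. \<Lambda> x c p) u) (inv_into UNIV (\<lambda>x. \<Lambda> x c p) v)"

definition ricci_soliton ::
    "('p, 'a::euclidean_space) chart set \<Rightarrow> ('p, 'a) metric_field \<Rightarrow> bool" where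
  "ricci_soliton A \<gamma> \<longleftrightarrow>
     (\<exists>X k. smooth_vector_field A X \<and>
        (\<forall>c\<in>A. \<forall>x\<in>snd c ` fst c. \<forall>u v.
           ricci (in_chart c \<gamma>) x u v
             + 1/2 * lie_derivative_metric (in_chart c X) (in_chart c \<gamma>) x u v
           = k * in_chart c \<gamma> x u v))"

text \<open>The sectional curvature is the same for all non-degenerate tangent planes at all points.\<close>

definition constant_curvature ::
    "('p, 'a::euclidean_space) chart set \<Rightarrow> ('p, 'a) metric_field \<Rightarrow> bool" where
  "constant_curvature A \<gamma> \<longleftrightarrow>
     (\<exists>k. \<forall>c\<in>A. \<forall>x\<in>snd c ` fst c. \<forall>u v.
        let \<gamma>x = in_chart c \<gamma> x; Q = \<gamma>x u u * \<gamma>x v v - (\<gamma>x u v)\<^sup>2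
        in Q \<noteq> 0 \<longrightarrow> \<gamma>x (riemann (in_chart c \<gamma>) x u v v) u / Q = k)"

end

(*
  Vanishing torsion forces D_u w = [u, w]_+ for u in E_- and w in E_+.  When the divergence is zero,
  the remaining freedom in D drops out of Ric^+, and in a frame v_a with g-dual frame v'_a the
  equation Ric^+ = 0 reads
    sum over a, b of (H - K)(v_a, x, v'_b) (H + K)(v_b, y, v'_a) = 0,
  where K(x, y, z) = 2 g(nabla_x y, z) is the Koszul expression.  The Jacobi identity makes the
  unimodular kernel u abelian, and in a frame adapted to u this quadratic system forces H = 0, rules
  out a degenerate or definite u, and leaves a Lorentzian plane u on which a boost produces the
  normal form of the bracket.

  In the left-invariant frame the Levi-Civita connection is d + N with 2 g(N x y, z) = K(x, y, z), so
  the curvature at every point is N_x N_y - N_y N_x - N_[x,y].  The soliton field is the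
  left-invariant field of -2 theta g(v_1, v_1) v_2, with soliton constant 0; the planes (v_1, v_2)
  and (v_1, v_3) have different sectional curvatures.
*)

theory Submission
  imports Defs
begin

section \<open>Traces and dual frames\<close>

text \<open>The quadratic system is decisive because of signs. With a, b, c, d the entries of
  \<open>ad v_2\<close> on the kernel and h = H(v_1, v_2, v_3), the equations for (v_1, v_1) and
  (v_3, v_3) give h^2 as c^2 - b^2 and as b^2 - c^2, and the one for (v_2, v_2) then admits a + d
  nonzero only if the plane is Lorentzian and c = - b. So \<open>ad v_2\<close> is g-selfadjoint on
  the kernel, and what remains of the equation says that the boost invariant of its trace-free part
  equals the square of half its trace. This fixes the operator up to boosts, reflections and scale,
  whence the single parameter. Traces, adjoints and Christoffel symbols are given by choice or
  description operators, so each is first identified through an explicit formula in a frame. The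
  passage from charts to the Lie algebra rests on two facts about the coframe inverse to the
  left-invariant frame: the Maurer-Cartan equation, which turns first derivatives into brackets, and
  the symmetry of its second derivatives, which removes them from the curvature.\<close>

lemma trace_on_frame:
  fixes e :: "'i \<Rightarrow> 'v::real_vector"
  assumes S: "subspace S" and I: "finite I" and eS: "\<And>i. i \<in> I \<Longrightarrow> e i \<in> S"
    and phi: "\<And>i. i \<in> I \<Longrightarrow> linear (\<phi> i)"
    and expand: "\<And>x. x \<in> S \<Longrightarrow> x = (\<Sum>i\<in>I. \<phi> i x *\<^sub>R e i)"
    and f: "linear f" and fS: "\<And>x. x \<in> S \<Longrightarrow> f x \<in> S"
  shows "trace_on S f = (\<Sum>i\<in>I. \<phi> i (f (e i)))"
proof -
  define B where "B = (SOME B. independent B \<and> span B = S)"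
  have "\<exists>B. independent B \<and> span B = S"
    by (metis S basis_exists span_eq_iff span_mono subset_antisym)
  then have B: "independent B" "span B = S"
    unfolding B_def by (metis (mono_tags, lifting) someI_ex)+
  have "S \<subseteq> span (e ` I)"
  proof
    fix x assume "x \<in> S"
    then have "x = (\<Sum>i\<in>I. \<phi> i x *\<^sub>R e i)" by (rule expand)
    also have "\<dots> \<in> span (e ` I)"
      by (intro span_sum span_scale span_base) auto
    finally show "x \<in> span (e ` I)" .
  qed
  then have finB: "finite B"
    using B I by (metis finite_imageI independent_span_bound span_superset subset_trans)
  have BS: "b \<in> S" if "b \<in> B" for b using B that span_base by auto
  have rep: "(\<Sum>b\<in>B. representation B x b *\<^sub>R b) = x" if "x \<in> S" for x
    using sum_representation_eq[OF B(1) _ finB order_refl, of x] that B(2) by simp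
  \<comment> \<open>Expanding \<open>e i\<close> in the chosen basis and \<open>f b\<close> in the
    family \<open>e\<close> leads to the same double sum, so \<open>e\<close> may even be linearly
    dependent.\<close>
  have "(\<Sum>i\<in>I. \<phi> i (f (e i))) =
      (\<Sum>i\<in>I. \<Sum>b\<in>B. representation B (e i) b * \<phi> i (f b))"
  proof (rule sum.cong[OF refl])
    fix i assume i: "i \<in> I"
    have "\<phi> i (f (e i)) = \<phi> i (f (\<Sum>b\<in>B. representation B (e i) b *\<^sub>R b))"
      using rep[OF eS[OF i]] by simp
    also have "\<dots> = (\<Sum>b\<in>B. representation B (e i) b * \<phi> i (f b))"
      using phi[OF i] by (simp add: linear_sum[OF f] linear_scale[OF f] linear_sum linear_scale)
    finally show "\<phi> i (f (e i)) = (\<Sum>b\<in>B. representation B (e i) b * \<phi> i (f b))" .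
  qed
  also have "\<dots> = (\<Sum>b\<in>B. \<Sum>i\<in>I. \<phi> i (f b) * representation B (e i) b)"
    by (subst sum.swap) (simp add: mult.commute)
  also have "\<dots> = (\<Sum>b\<in>B. representation B (f b) b)"
  proof (rule sum.cong[OF refl])
    fix b assume b: "b \<in> B"
    have "representation B (f b) b = representation B (\<Sum>i\<in>I. \<phi> i (f b) *\<^sub>R e i) b"
      using expand[OF fS[OF BS[OF b]]] by simp
    also have "\<dots> = (\<Sum>i\<in>I. representation B (\<phi> i (f b) *\<^sub>R e i) b)"
      using B eS S by (subst representation_sum) (auto simp: subspace_scale)
    also have "\<dots> = (\<Sum>i\<in>I. \<phi> i (f b) * representation B (e i) b)"
      using B eS by (intro sum.cong refl) (simp add: representation_scale)
    finally show "(\<Sum>i\<in>I. \<phi> i (f b) * representation B (e i) b) = representation B (f b) b" ..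
  qed
  finally show ?thesis by (simp add: trace_on_def B_def Let_def)
qed

text \<open>\<open>2 g(\<nabla>\<^sub>x y, z)\<close> for the Levi-Civita connection \<open>\<nabla>\<close> of the left-invariant metric \<open>g\<close>.\<close>

definition koszul :: "('a::real_vector \<Rightarrow> 'a \<Rightarrow> 'a) \<Rightarrow> ('a \<Rightarrow> 'a \<Rightarrow> real) \<Rightarrow> 'a \<Rightarrow> 'a \<Rightarrow> 'a \<Rightarrow> real" where
  "koszul br g x y z = g (br x y) z - g (br y z) x + g (br z x) y"

text \<open>The family \<open>v'\<close> is separate from \<open>v\<close> because in a null frame
  the dual of a vector is not a multiple of it.\<close>

definition dual_frame :: "('a::real_vector \<Rightarrow> 'a \<Rightarrow> real) \<Rightarrow> 'i set \<Rightarrow> ('i \<Rightarrow> 'a) \<Rightarrow> ('i \<Rightarrow> 'a) \<Rightarrow> bool" where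
  "dual_frame g I v v' \<longleftrightarrow> finite I \<and> (\<forall>x. x = (\<Sum>i\<in>I. g x (v' i) *\<^sub>R v i))"

text \<open>Expanding \<open>x\<close> turns \<open>g x y\<close> into the sum of
  \<open>g x (v' i) * g (v i) y\<close>, in which the two families play symmetric roles;
  nondegeneracy then strips off \<open>x\<close>.\<close>

lemma dual_frame_swap:
  fixes g :: "'a::real_normed_vector \<Rightarrow> 'a \<Rightarrow> real"
  assumes g: "scalar_product g" and v: "dual_frame g I v v'"
  shows "dual_frame g I v' v"
proof -
  have bil: "bilinear g" and sym: "\<And>x y. g x y = g y x" and nd: "nondegenerate_on UNIV g"
    using g by (auto simp: scalar_product_def)
  have "y = (\<Sum>i\<in>I. g y (v i) *\<^sub>R v' i)" for y
  proof -
    have lin: "linear (\<lambda>x. g x y)" "linear (g x)" for x y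
      using bil by (auto simp: bilinear_def)
    have eq: "g x y = g x (\<Sum>i\<in>I. g y (v i) *\<^sub>R v' i)" for x
    proof -
      have "g x y = g (\<Sum>i\<in>I. g x (v' i) *\<^sub>R v i) y"
        using v unfolding dual_frame_def by metis
      also have "\<dots> = (\<Sum>i\<in>I. g x (v' i) * g (v i) y)"
        by (simp add: linear_sum[OF lin(1)] linear_scale[OF lin(1)])
      also have "\<dots> = g x (\<Sum>i\<in>I. g y (v i) *\<^sub>R v' i)"
        by (simp add: linear_sum[OF lin(2)] linear_scale[OF lin(2)] sym[of y] mult.commute)
      finally show ?thesis .
    qed
    have "\<forall>x. g (y - (\<Sum>i\<in>I. g y (v i) *\<^sub>R v' i)) x = 0"
      using eq by (metis diff_self linear_diff[OF lin(2)] sym)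
    then show ?thesis using nd by (auto simp: nondegenerate_on_def)
  qed
  then show ?thesis using v by (simp add: dual_frame_def)
qed

section \<open>The Einstein equation in a frame\<close>

definition gplus :: "('a::euclidean_space \<Rightarrow> 'a \<Rightarrow> real) \<Rightarrow> 'a \<Rightarrow> 'a gen" where
  "gplus g x = (x, Blinfun (g x))"

definition gminus :: "('a::euclidean_space \<Rightarrow> 'a \<Rightarrow> real) \<Rightarrow> 'a \<Rightarrow> 'a gen" where
  "gminus g x = (x, - Blinfun (g x))"

lemma E_plus_gplus: "E_plus g = range (gplus g)"
  by (simp add: E_plus_def gplus_def[abs_def])

lemma E_minus_gminus: "E_minus g = range (gminus g)"
  by (simp add: E_minus_def gminus_def[abs_def])

lemma pairing_sym: "pairing u w = pairing w u"
  by (simp add: pairing_def)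

lemma bilinear_pairing: "bilinear pairing"
  unfolding bilinear_def pairing_def
  by (auto intro!: linearI simp: blinfun.add_left blinfun.add_right blinfun.scaleR_left
      blinfun.scaleR_right field_simps)

lemmas linear_pairing_left = bilinear_pairing[unfolded bilinear_def, THEN conjunct2, rule_format]
lemmas linear_pairing_right = bilinear_pairing[unfolded bilinear_def, THEN conjunct1, rule_format]

lemma Blinfun_linear: "linear f \<Longrightarrow> blinfun_apply (Blinfun f) y = f y"
  for f :: "'a::euclidean_space \<Rightarrow> 'b::real_normed_vector"
  by (simp add: bounded_linear_Blinfun_apply linear_conv_bounded_linear)

section \<open>Frame coefficients, adjoints and traces on the generalized tangent space\<close>

locale metric_frame =
  fixes g :: "'a::euclidean_space \<Rightarrow> 'a \<Rightarrow> real" and I :: "'i set" and v v' :: "'i \<Rightarrow> 'a"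
  assumes g: "scalar_product g" and frame: "dual_frame g I v v'"
begin

lemma g_sym: "g x y = g y x"
  using g by (simp add: scalar_product_def)

lemma linear_g: "linear (g x)" "linear (\<lambda>x. g x y)"
  using g by (auto simp: scalar_product_def bilinear_def)

lemma finite_I: "finite I"
  using frame by (simp add: dual_frame_def)

lemma g_expand: "x = (\<Sum>i\<in>I. g x (v' i) *\<^sub>R v i)"
  using frame unfolding dual_frame_def by blast

lemma g_expand': "x = (\<Sum>i\<in>I. g x (v i) *\<^sub>R v' i)"
  using dual_frame_swap[OF g frame] unfolding dual_frame_def by blast

text \<open>The opposite signs on the two summands are the source of the minus signs that accompany
  \<open>gminus\<close> coefficients below.\<close>

lemma pairing_frame [simp]:
  "pairing (gplus g x) (gplus g y) = g x y"
  "pairing (gminus g x) (gminus g y) = - g x y"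
  "pairing (gplus g x) (gminus g y) = 0"
  "pairing (gminus g x) (gplus g y) = 0"
  by (auto simp: pairing_def gplus_def gminus_def Blinfun_linear[OF linear_g(1)] blinfun.minus_left
      g_sym[of y])

lemma linear_gplus: "linear (gplus g)"
  by (auto intro!: linearI blinfun_eqI
      simp: gplus_def blinfun.add_left blinfun.scaleR_left
        Blinfun_linear[OF linear_g(1)] linear_add[OF linear_g(2)] linear_scale[OF linear_g(2)])

text \<open>For \<open>w = (x, \<xi>)\<close> the coefficients are halves of
  \<open>g x + \<xi>\<close> and \<open>g x - \<xi>\<close> on \<open>v' i\<close>. The vector parts
  add up to the expansion of \<open>x\<close> in \<open>v\<close>, the covector parts to
  \<open>\<xi>\<close> evaluated through the swapped expansion.\<close>

lemma gen_expand:
  "w = (\<Sum>i\<in>I. pairing w (gplus g (v' i)) *\<^sub>R gplus g (v i)) +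
       (\<Sum>i\<in>I. (- pairing w (gminus g (v' i))) *\<^sub>R gminus g (v i))"
proof -
  obtain x \<xi> where w: "w = (x, \<xi>)" by (cases w)
  have coeff: "pairing w (gplus g y) = (blinfun_apply \<xi> y + g x y) / 2"
      "- pairing w (gminus g y) = (g x y - blinfun_apply \<xi> y) / 2" for y
    by (auto simp: w pairing_def gplus_def gminus_def Blinfun_linear[OF linear_g(1)]
        blinfun.minus_left g_sym[of y] field_simps)
  have "(\<Sum>i\<in>I. pairing w (gplus g (v' i)) *\<^sub>R v i) +
        (\<Sum>i\<in>I. (- pairing w (gminus g (v' i))) *\<^sub>R v i) = (\<Sum>i\<in>I. g x (v' i) *\<^sub>R v i)"
    unfolding coeff sum.distrib[symmetric] scaleR_left_distrib[symmetric]
    by (intro sum.cong refl arg_cong2[where f = scaleR]) (simp add: field_simps)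
  then have fst_eq: "(\<Sum>i\<in>I. pairing w (gplus g (v' i)) *\<^sub>R v i) +
        (\<Sum>i\<in>I. (- pairing w (gminus g (v' i))) *\<^sub>R v i) = x"
    using g_expand[of x] by simp
  have snd_eq: "(\<Sum>i\<in>I. pairing w (gplus g (v' i)) * g (v i) y) +
        (\<Sum>i\<in>I. - pairing w (gminus g (v' i)) * - g (v i) y) = blinfun_apply \<xi> y" for y
  proof -
    have "(\<Sum>i\<in>I. pairing w (gplus g (v' i)) * g (v i) y) +
        (\<Sum>i\<in>I. - pairing w (gminus g (v' i)) * - g (v i) y) =
        (\<Sum>i\<in>I. g y (v i) * blinfun_apply \<xi> (v' i))"
      unfolding coeff sum.distrib[symmetric]
      by (intro sum.cong refl) (simp add: field_simps g_sym[of y])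
    also have "\<dots> = blinfun_apply \<xi> (\<Sum>i\<in>I. g y (v i) *\<^sub>R v' i)"
      by (simp add: blinfun.sum_right blinfun.scaleR_right)
    finally show ?thesis using g_expand'[of y] by simp
  qed
  have "snd ((\<Sum>i\<in>I. pairing w (gplus g (v' i)) *\<^sub>R gplus g (v i)) +
       (\<Sum>i\<in>I. (- pairing w (gminus g (v' i))) *\<^sub>R gminus g (v i))) = \<xi>"
    by (rule blinfun_eqI)
      (simp add: snd_sum blinfun.sum_left blinfun.add_left blinfun.scaleR_left blinfun.minus_left
        gplus_def[of g "v _"] gminus_def[of g "v _"] Blinfun_linear[OF linear_g(1)] snd_eq[simplified])
  moreover have "fst ((\<Sum>i\<in>I. pairing w (gplus g (v' i)) *\<^sub>R gplus g (v i)) +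
       (\<Sum>i\<in>I. (- pairing w (gminus g (v' i))) *\<^sub>R gminus g (v i))) = x"
    by (simp add: fst_sum gplus_def[of g "v _"] gminus_def[of g "v _"] fst_eq[simplified])
  ultimately show ?thesis by (simp add: w prod_eq_iff)
qed

lemma pairing_eqI:
  fixes y z :: "'a gen"
  shows "(\<And>w. pairing y w = pairing z w) \<Longrightarrow> y = z"
  using gen_expand[of y] gen_expand[of z] by simp

text \<open>The adjoint is a definite description, so a solution must be exhibited first: the frame
  supplies one, and \<open>pairing_eqI\<close> its uniqueness.\<close>

lemma pairing_adjoint:
  fixes f :: "'a gen \<Rightarrow> 'a gen"
  assumes f: "linear f"
  shows "pairing (pairing_adjoint f y) w = pairing y (f w)"
proof -
  let ?z = "(\<Sum>i\<in>I. pairing y (f (gplus g (v i))) *\<^sub>R gplus g (v' i)) +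
      (\<Sum>i\<in>I. (- pairing y (f (gminus g (v i)))) *\<^sub>R gminus g (v' i))"
  have z: "pairing ?z w = pairing y (f w)" for w
  proof -
    have "pairing y (f w) = pairing y (f ((\<Sum>i\<in>I. pairing w (gplus g (v' i)) *\<^sub>R gplus g (v i)) +
       (\<Sum>i\<in>I. (- pairing w (gminus g (v' i))) *\<^sub>R gminus g (v i))))"
      using gen_expand[of w] by simp
    then show ?thesis
      by (simp add: linear_add[OF f] linear_sum[OF f] linear_scale[OF f] linear_add[OF linear_pairing_left]
          linear_sum[OF linear_pairing_left] linear_scale[OF linear_pairing_left]
          linear_add[OF linear_pairing_right] linear_neg[OF f] linear_neg[OF linear_pairing_left]
          linear_neg[OF linear_pairing_right] linear_diff[OF linear_pairing_left]
          linear_diff[OF linear_pairing_right] linear_diff[OF f]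
          linear_sum[OF linear_pairing_right] linear_scale[OF linear_pairing_right]
          sum_negf pairing_sym[of _ w] mult.commute)
  qed
  have "pairing_adjoint f y = ?z"
    unfolding pairing_adjoint_def
  proof (rule the_equality)
    show "\<forall>w. pairing ?z w = pairing y (f w)" using z by blast
    show "z' = ?z" if "\<forall>w. pairing z' w = pairing y (f w)" for z'
      by (rule pairing_eqI) (simp only: z that[rule_format])
  qed
  then show ?thesis using z by simp
qed

lemma trace_E_plus:
  assumes f: "linear f" "\<And>x. f (gplus g x) \<in> E_plus g"
  shows "trace_on (E_plus g) f = (\<Sum>i\<in>I. pairing (f (gplus g (v i))) (gplus g (v' i)))"
proof (rule trace_on_frame[OF _ finite_I])
  show "subspace (E_plus g)"
    unfolding E_plus_gplus using linear_gplus by (rule linear_subspace_image) simp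
  show "x = (\<Sum>i\<in>I. pairing x (gplus g (v' i)) *\<^sub>R gplus g (v i))" if "x \<in> E_plus g" for x
  proof -
    from that obtain y where "x = gplus g y" by (auto simp: E_plus_gplus)
    then have "pairing x (gminus g z) = 0" for z by simp
    then show ?thesis by (intro trans[OF gen_expand[of x]]) simp
  qed
qed (use f in \<open>auto simp: E_plus_gplus linear_pairing_left\<close>)

lemma trace_gen:
  assumes f: "linear f"
  shows "trace_on UNIV f = (\<Sum>i\<in>I. pairing (f (gplus g (v i))) (gplus g (v' i)))
      - (\<Sum>i\<in>I. pairing (f (gminus g (v i))) (gminus g (v' i)))"
proof -
  let ?e = "case_sum (\<lambda>i. gplus g (v i)) (\<lambda>i. gminus g (v i))"
  let ?p = "case_sum (\<lambda>i w. pairing w (gplus g (v' i))) (\<lambda>i w. - pairing w (gminus g (v' i)))"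
  have "trace_on UNIV f = (\<Sum>i\<in>I <+> I. ?p i (f (?e i)))"
  proof (rule trace_on_frame)
    show "x = (\<Sum>i\<in>I <+> I. ?p i x *\<^sub>R ?e i)" for x
      using gen_expand[of x] by (simp add: sum.Plus finite_I)
  qed (auto simp: finite_I f linear_pairing_left intro!: linear_compose_neg split: sum.splits)
  then show ?thesis by (simp add: sum.Plus finite_I sum_negf)
qed

end

section \<open>The Dorfman bracket in terms of \<open>H\<close> and the Koszul expression\<close>

lemma coad_apply:
  "bilinear br \<Longrightarrow> blinfun_apply (coad br x \<eta>) y = blinfun_apply \<eta> (br x y)"
  by (simp add: coad_def Blinfun_linear bilinear_def)

lemma bilinear_dorfman:
  fixes br :: "'a::euclidean_space \<Rightarrow> 'a \<Rightarrow> 'a"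
  assumes br: "bilinear br" and H: "three_form H"
  shows "bilinear (dorfman br H)"
proof -
  have Hlin: "\<And>x y. linear (H x y)" "\<And>y z. linear (\<lambda>x. H x y z)" "\<And>x z. linear (\<lambda>y. H x y z)"
    using H by (auto simp: three_form_def)
  show ?thesis
    unfolding bilinear_def dorfman_def
    by (auto intro!: linearI blinfun_eqI
        simp: bilinear_ladd[OF br] bilinear_radd[OF br] bilinear_lmul[OF br] bilinear_rmul[OF br]
          blinfun.add_left blinfun.scaleR_left blinfun.minus_left blinfun.diff_left coad_apply[OF br]
          Blinfun_linear[OF Hlin(1)] blinfun.add_right blinfun.scaleR_right
          linear_add[OF Hlin(2)] linear_scale[OF Hlin(2)]
          linear_add[OF Hlin(3)] linear_scale[OF Hlin(3)] algebra_simps)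
qed

lemma three_form_skew:
  assumes "three_form H"
  shows "H y x z = - H x y z" "H x z y = - H x y z"
proof -
  have lin: "\<And>x y. linear (H x y)" "\<And>y z. linear (\<lambda>x. H x y z)" "\<And>x z. linear (\<lambda>y. H x y z)"
    and alt: "\<And>x y. H x x y = 0" "\<And>x y. H x y y = 0"
    using assms by (auto simp: three_form_def)
  have "H (x + y) (x + y) z = H x x z + H x y z + H y x z + H y y z"
    by (simp add: linear_add[OF lin(2)] linear_add[OF lin(3)])
  then show "H y x z = - H x y z" by (simp add: alt)
  have "H x (y + z) (y + z) = H x y y + H x y z + H x z y + H x z z"
    by (simp add: linear_add[OF lin(1)] linear_add[OF lin(3)])
  then show "H x z y = - H x y z" by (simp add: alt)
qed

lemma bilinear_alt_skew:
  assumes "bilinear br" "\<And>x. br x x = 0"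
  shows "br y x = - br x y"
proof -
  have "br (x + y) (x + y) = br x x + br x y + br y x + br y y"
    by (simp add: bilinear_ladd[OF assms(1)] bilinear_radd[OF assms(1)])
  then show ?thesis by (simp add: assms(2) eq_neg_iff_add_eq_0 add.commute)
qed

lemma dorfman_skew:
  fixes br :: "'a::euclidean_space \<Rightarrow> 'a \<Rightarrow> 'a"
  assumes br: "bilinear br" "\<And>x. br x x = 0" and H: "three_form H"
  shows "dorfman br H u w = - dorfman br H w u"
proof -
  have Hlin: "\<And>x y. linear (H x y)" using H by (auto simp: three_form_def)
  have "Blinfun (H (fst u) (fst w)) = - Blinfun (H (fst w) (fst u))"
    by (rule blinfun_eqI)
      (simp add: Blinfun_linear[OF Hlin] blinfun.minus_left three_form_skew(1)[OF H, of "fst u" "fst w"])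
  then show ?thesis
    by (simp add: dorfman_def bilinear_alt_skew[OF br, of "fst u" "fst w"])
qed

lemma sum_mult_swap:
  "(\<Sum>i\<in>I. \<Sum>j\<in>I. f i j * h j i) = (\<Sum>i\<in>I. \<Sum>j\<in>I. h i j * f j i)"
  for f h :: "'i \<Rightarrow> 'i \<Rightarrow> real"
  by (subst sum.swap) (simp add: mult.commute)

context metric_frame
begin

text \<open>The mixed brackets are the metric connections with skew torsion,
  \<open>g(\<nabla>_a x, b) + H(a, x, b)/2\<close> on \<open>E_plus\<close> and the one with
  \<open>- H\<close> on \<open>E_minus\<close>, where the pairing is \<open>- g\<close>.\<close>

lemma pairing_dorfman:
  assumes br: "bilinear br" "\<And>x. br x x = 0" and H: "three_form H"
  shows "pairing (dorfman br H (gplus g a) (gminus g x)) (gminus g b) = (H a x b - koszul br g a x b) / 2"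
    and "pairing (dorfman br H (gminus g a) (gplus g x)) (gplus g b) = (H a x b + koszul br g a x b) / 2"
proof -
  have Hlin: "\<And>x y. linear (H x y)" using H by (auto simp: three_form_def)
  have gneg: "g (- p) q = - g p q" for p q using linear_neg[OF linear_g(2)] .
  have "br b a = - br a b" "br x b = - br b x" by (rule bilinear_alt_skew[OF br])+
  then show "pairing (dorfman br H (gplus g a) (gminus g x)) (gminus g b) = (H a x b - koszul br g a x b) / 2"
    "pairing (dorfman br H (gminus g a) (gplus g x)) (gplus g b) = (H a x b + koszul br g a x b) / 2"
    by (simp_all add: pairing_def dorfman_def gplus_def gminus_def koszul_def blinfun.add_left
        blinfun.minus_left blinfun.diff_left coad_apply[OF br(1)] Blinfun_linear[OF linear_g(1)]
        Blinfun_linear[OF Hlin] gneg g_sym[of a] g_sym[of x] g_sym[of b])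
qed

lemma einstein_frame_equation:
  assumes br: "bilinear br" "\<And>x. br x x = 0" and H: "three_form H"
    and D: "gen_levi_civita br H g D" and div: "\<And>w. gen_divergence D w = 0"
    and ric: "\<And>u w. u \<in> E_minus g \<Longrightarrow> w \<in> E_plus g \<Longrightarrow> gen_ric_plus br H g D u w = 0"
  shows "(\<Sum>a\<in>I. \<Sum>b\<in>I. (H (v a) x (v' b) - koszul br g (v a) x (v' b)) *
            (H (v b) y (v' a) + koszul br g (v b) y (v' a))) = 0"
proof -
  have bilD: "bilinear D"
    using D by (auto simp: gen_levi_civita_def gen_connection_def)
  have linD: "linear (\<lambda>u. D u w)" "linear (D u)" for u w
    using bilD unfolding bilinear_def by blast+
  have bilB: "bilinear (dorfman br H)" by (rule bilinear_dorfman[OF br(1) H])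
  have linB: "linear (\<lambda>u. dorfman br H u w)" for w
    using bilB unfolding bilinear_def by blast
  have Dplus: "\<exists>z. D u (gplus g x) = gplus g z" for u x
    using D unfolding gen_levi_civita_def E_plus_gplus by blast
  have Dminus: "\<exists>z. D u (gminus g x) = gminus g z" for u x
    using D unfolding gen_levi_civita_def E_minus_gminus by blast
  have orth [simp]: "pairing (D u (gplus g x)) (gminus g z) = 0" "pairing (D u (gminus g x)) (gplus g z) = 0"
    "pairing (gplus g x) (D u (gminus g z)) = 0" for u x z
    using Dplus[of u x] Dminus[of u x] Dminus[of u z] by auto
  have torsion: "pairing (D u w) z - pairing (D w u) z - pairing (dorfman br H u w) z
      + pairing w (D z u) = 0" for u w z
  proof -
    have "gen_torsion br H D u w = 0"
      using D unfolding gen_levi_civita_def by blast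
    then have "pairing (gen_torsion br H D u w) z = pairing 0 z" by simp
    then show ?thesis
      by (simp add: gen_torsion_def linear_add[OF linear_pairing_left] linear_diff[OF linear_pairing_left]
          pairing_adjoint[OF linD(1)] linear_0[OF linear_pairing_left])
  qed
  have mixed: "pairing (D (gminus g x) (gplus g y)) (gplus g z) =
      pairing (dorfman br H (gminus g x) (gplus g y)) (gplus g z)" for x y z
    using torsion[of "gminus g x" "gplus g y" "gplus g z"] by simp
  define u where "u = gminus g x"
  define w where "w = gplus g y"
  define e e' f f' where "e i = gplus g (v i)" and "e' i = gplus g (v' i)"
    and "f i = gminus g (v i)" and "f' i = gminus g (v' i)" for i
  note frame_defs = u_def w_def e_def e'_def f_def f'_def
  let ?R = "\<lambda>z. gen_curvature br H D z u w"
  have linR: "linear ?R"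
    unfolding gen_curvature_def
    by (intro linear_compose_sub linD linear_compose[OF linB linD(1), unfolded comp_def]
        linear_compose[OF linD(1) linD(2), unfolded comp_def])
  have closed: "a - b \<in> E_plus g" if "a \<in> E_plus g" "b \<in> E_plus g" for a b
    using that linear_diff[OF linear_gplus, symmetric] by (auto simp: E_plus_gplus)
  have Dclosed: "D z a \<in> E_plus g" if "a \<in> E_plus g" for z a
    using that Dplus unfolding E_plus_gplus by blast
  have "w \<in> E_plus g" by (simp add: w_def E_plus_gplus)
  then have "trace_on (E_plus g) ?R = (\<Sum>i\<in>I. pairing (?R (e i)) (e' i))"
    unfolding e_def e'_def
    by (intro trace_E_plus linR) (simp add: gen_curvature_def closed Dclosed)
  moreover have "gen_ric_plus br H g D u w = 0"
    by (rule ric) (auto simp: u_def w_def E_plus_gplus E_minus_gminus)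
  ultimately have "(\<Sum>i\<in>I. pairing (?R (e i)) (e' i)) = 0"
    by (simp add: gen_ric_plus_def)
  moreover have "pairing (?R (e i)) (e' i) =
      pairing (D (e i) (D u w)) (e' i)
      - (\<Sum>j\<in>I. pairing (D (e i) w) (e' j) * pairing (D u (e j)) (e' i))
      + (\<Sum>j\<in>I. pairing (D u (e i)) (e' j) * pairing (D (e j) w) (e' i))
      + (\<Sum>j\<in>I. pairing (dorfman br H (e i) u) (f' j) * pairing (D (f j) w) (e' i))" for i
  proof -
    obtain z where z: "D (e i) w = gplus g z" using Dplus w_def by metis
    have "D (e i) w = (\<Sum>j\<in>I. pairing (D (e i) w) (e' j) *\<^sub>R e j)"
      unfolding z unfolding e_def e'_def by (rule trans[OF gen_expand]) simp
    then have "pairing (D u (D (e i) w)) (e' i) =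
        pairing (D u (\<Sum>j\<in>I. pairing (D (e i) w) (e' j) *\<^sub>R e j)) (e' i)"
      by (rule arg_cong)
    then have 1: "pairing (D u (D (e i) w)) (e' i) =
        (\<Sum>j\<in>I. pairing (D (e i) w) (e' j) * pairing (D u (e j)) (e' i))"
      by (simp only: linear_scale[OF linD(2)] linear_sum[OF linD(2)]
          linear_scale[OF linear_pairing_left] linear_sum[OF linear_pairing_left] real_scaleR_def)
    \<comment> \<open>The \<open>E_plus\<close> part of \<open>[e i, u]\<close> is
      \<open>- D u (e i)\<close> by \<open>mixed\<close>; this is what lets the unknown components
      \<open>D (e j) w\<close> cancel later.\<close>
    have skew: "pairing (dorfman br H (e i) u) (e' j) = - pairing (D u (e i)) (e' j)" for j
      unfolding frame_defs mixed dorfman_skew[OF br H, of "gplus g (v i)"]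
      by (rule linear_neg[OF linear_pairing_left])
    have "dorfman br H (e i) u =
        (\<Sum>j\<in>I. (- pairing (D u (e i)) (e' j)) *\<^sub>R e j) +
        (\<Sum>j\<in>I. (- pairing (dorfman br H (e i) u) (f' j)) *\<^sub>R f j)"
      using gen_expand[of "dorfman br H (e i) u", folded e_def e'_def f_def f'_def] unfolding skew .
    then have "pairing (D (dorfman br H (e i) u) w) (e' i) =
       pairing (D ((\<Sum>j\<in>I. (- pairing (D u (e i)) (e' j)) *\<^sub>R e j) +
        (\<Sum>j\<in>I. (- pairing (dorfman br H (e i) u) (f' j)) *\<^sub>R f j)) w) (e' i)" 
      by (rule arg_cong)
    also have "\<dots> = - (\<Sum>j\<in>I. pairing (D u (e i)) (e' j) * pairing (D (e j) w) (e' i))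
       - (\<Sum>j\<in>I. pairing (dorfman br H (e i) u) (f' j) * pairing (D (f j) w) (e' i))"
      by (simp only: linear_add[OF linD(1)] linear_sum[OF linD(1)] linear_scale[OF linD(1)]
        linear_add[OF linear_pairing_left] linear_sum[OF linear_pairing_left]
        linear_scale[OF linear_pairing_left]) (simp add: sum_negf)
    finally show ?thesis
      using 1 by (simp add: gen_curvature_def linear_diff[OF linear_pairing_left])
  qed
  \<comment> \<open>\<open>D u w\<close> lies in \<open>E_plus\<close>, so the
    \<open>E_minus\<close> half of its divergence vanishes and this partial trace is the whole
    divergence.\<close>
  moreover have "(\<Sum>i\<in>I. pairing (D (e i) (D u w)) (e' i)) = 0"
  proof -
    obtain z where z: "D u w = gplus g z" using Dplus w_def by metis
    show ?thesis
      using div[of "D u w"] unfolding gen_divergence_def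
      by (simp add: trace_gen[OF linD(1)] z e_def e'_def)
  qed
  (* The two middle sums are tr(AB) and tr(BA) for A = D_u and B = (z \<mapsto> D_z w) on E_+, so they cancel. *)
  ultimately have "(\<Sum>i\<in>I. \<Sum>j\<in>I. pairing (dorfman br H (e i) u) (f' j) * pairing (D (f j) w) (e' i)) = 0"
    using sum_mult_swap[of "\<lambda>i j. pairing (D (e i) w) (e' j)" "\<lambda>j i. pairing (D u (e j)) (e' i)" I]
    by (simp add: sum.distrib sum_subtractf)
  then have "(\<Sum>i\<in>I. \<Sum>j\<in>I. (H (v i) x (v' j) - koszul br g (v i) x (v' j)) / 2 *
            ((H (v j) y (v' i) + koszul br g (v j) y (v' i)) / 2)) = 0"
    unfolding frame_defs mixed pairing_dorfman[OF br H] .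
  then show ?thesis
    by (simp add: sum_divide_distrib[symmetric])
qed

end

section \<open>Adapted frames\<close>

text \<open>If the orthogonal complement of \<open>S\<close> had only null vectors, \<open>g\<close>
  would vanish on it by polarization. A nonzero \<open>w\<close> there would be orthogonal to
  \<open>S\<close> and to its complement, which together span because \<open>S\<close> is orthogonal
  and nonnull, against nondegeneracy.\<close>

lemma nonnull_orthogonal_exists:
  fixes g :: "'a::euclidean_space \<Rightarrow> 'a \<Rightarrow> real"
  assumes g: "scalar_product g" and S: "finite S" "card S < DIM('a)"
    and nonnull: "\<And>s. s \<in> S \<Longrightarrow> g s s \<noteq> 0"
    and orth: "\<And>s t. s \<in> S \<Longrightarrow> t \<in> S \<Longrightarrow> s \<noteq> t \<Longrightarrow> g s t = 0"
  shows "\<exists>w. g w w \<noteq> 0 \<and> (\<forall>s\<in>S. g w s = 0)"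
proof (rule ccontr)
  assume "\<not> ?thesis"
  then have null: "g w w = 0" if "\<forall>s\<in>S. g w s = 0" for w using that by blast
  have lin: "linear (g x)" "linear (\<lambda>x. g x y)" and sym: "g x y = g y x"
    and nd: "(\<And>y. g x y = 0) \<Longrightarrow> x = 0" for x y
    using g by (auto simp: scalar_product_def bilinear_def nondegenerate_on_def)
  note lin_simps = linear_add[OF lin(1)] linear_add[OF lin(2)] linear_scale[OF lin(1)]
    linear_scale[OF lin(2)] linear_diff[OF lin(1)] linear_diff[OF lin(2)]
    linear_sum[OF lin(1)] linear_sum[OF lin(2)]
  have polar: "g w z = 0" if "\<forall>s\<in>S. g w s = 0" "\<forall>s\<in>S. g z s = 0" for w z
  proof -
    have "g (w + z) (w + z) = 0"
      by (rule null) (simp add: linear_add[OF lin(2)] that)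
    moreover have "g w w = 0" "g z z = 0" using that by (auto intro: null)
    ultimately show ?thesis by (simp add: lin_simps sym[of z w])
  qed
  \<comment> \<open>\<open>G s\<close> represents the functional \<open>g _ s\<close> by the
    Euclidean inner product, so an ordinary orthogonal complement yields a nonzero vector that is
    g-orthogonal to \<open>S\<close>.\<close>
  define G where "G s = (\<Sum>b\<in>Basis. g b s *\<^sub>R b)" for s
  have G: "w \<bullet> G s = g w s" for w s
  proof -
    have "g w s = g (\<Sum>b\<in>Basis. (w \<bullet> b) *\<^sub>R b) s" by (simp add: euclidean_representation)
    also have "\<dots> = w \<bullet> G s" by (simp add: G_def lin_simps inner_sum_right mult.commute)
    finally show ?thesis ..
  qed
  have "dim (G ` S) \<le> card (G ` S)" using S by (intro dim_le_card') simp
  also have "\<dots> \<le> card S" using S by (intro card_image_le)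
  finally have "dim (G ` S) < DIM('a)" using S by simp
  then obtain w where w: "w \<noteq> 0" "\<And>y. y \<in> span (G ` S) \<Longrightarrow> orthogonal w y"
    using orthogonal_to_subspace_exists by metis
  have wS: "\<forall>s\<in>S. g w s = 0"
  proof
    fix s assume "s \<in> S"
    then have "orthogonal w (G s)" by (intro w(2) span_base) simp
    then show "g w s = 0" by (simp add: orthogonal_def G)
  qed
  have "g w x = 0" for x
  proof -
    define p where "p = (\<Sum>s\<in>S. (g x s / g s s) *\<^sub>R s)"
    have "g (x - p) t = 0" if t: "t \<in> S" for t
    proof -
      have "(\<Sum>s\<in>S. g x s / g s s * g s t) = (\<Sum>s\<in>S. if s = t then g x t else 0)"
        using nonnull orth t by (intro sum.cong) auto
      then show ?thesis using S t by (simp add: p_def lin_simps)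
    qed
    then have "g w (x - p) = 0" using wS by (intro polar) auto
    moreover have "g w p = 0" using wS by (simp add: p_def lin_simps)
    ultimately show ?thesis by (simp add: lin_simps)
  qed
  then have "w = 0" by (rule nd)
  with w show False by simp
qed

lemma span_three: "x \<in> span {u, v, w} \<longleftrightarrow> (\<exists>a b c. x = a *\<^sub>R u + b *\<^sub>R v + c *\<^sub>R w)"
  by (auto simp: span_breakdown_eq algebra_simps)

text \<open>Common form of orthonormal frames, whose duals are sign multiples, and of frames with a
  hyperbolic pair of null vectors, which are dual to each other.\<close>

definition dual_triples ::
    "('a::real_vector \<Rightarrow> 'a \<Rightarrow> real) \<Rightarrow> 'a \<Rightarrow> 'a \<Rightarrow> 'a \<Rightarrow> 'a \<Rightarrow> 'a \<Rightarrow> 'a \<Rightarrow> bool" where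
  "dual_triples g u v w u' v' w' \<longleftrightarrow>
     g u u' = 1 \<and> g u v' = 0 \<and> g u w' = 0 \<and> g v u' = 0 \<and> g v v' = 1 \<and> g v w' = 0 \<and>
     g w u' = 0 \<and> g w v' = 0 \<and> g w w' = 1"

lemma dual_triples_basis:
  fixes g :: "'a::euclidean_space \<Rightarrow> 'a \<Rightarrow> real"
  assumes g: "bilinear g" and dim: "DIM('a) = 3" and d: "dual_triples g u v w u' v' w'"
  shows "independent {u, v, w}" "span {u, v, w} = UNIV"
    and "x = g x u' *\<^sub>R u + g x v' *\<^sub>R v + g x w' *\<^sub>R w"
    and "dual_frame g {0, 1, 2::nat} (\<lambda>i. [u, v, w] ! i) (\<lambda>i. [u', v', w'] ! i)"
proof -
  have lin: "linear (g x)" "linear (\<lambda>x. g x y)" for x y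
    using g by (auto simp: bilinear_def)
  note lin_simps = linear_add[OF lin(2)] linear_scale[OF lin(2)] linear_0[OF lin(2)]
  note d = d[unfolded dual_triples_def]
  have coeff: "g (a *\<^sub>R u + b *\<^sub>R v + c *\<^sub>R w) u' = a" "g (a *\<^sub>R u + b *\<^sub>R v + c *\<^sub>R w) v' = b"
    "g (a *\<^sub>R u + b *\<^sub>R v + c *\<^sub>R w) w' = c" for a b c
    using d by (auto simp: lin_simps)
  have distinct: "u \<noteq> v" "u \<noteq> w" "v \<noteq> w" using d by auto
  show ind: "independent {u, v, w}"
  proof (rule independent_if_scalars_zero)
    fix f x assume "(\<Sum>x\<in>{u, v, w}. f x *\<^sub>R x) = 0" and x: "x \<in> {u, v, w}"
    then have "f u *\<^sub>R u + f v *\<^sub>R v + f w *\<^sub>R w = 0" using distinct by (simp add: add.assoc)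
    then have "f u = 0" "f v = 0" "f w = 0"
      using coeff[of "f u" "f v" "f w"] linear_0[OF lin(2)] by metis+
    then show "f x = 0" using x by auto
  qed simp
  have "UNIV \<subseteq> span {u, v, w}"
    by (rule card_ge_dim_independent[OF _ ind]) (use distinct dim in auto)
  then show span: "span {u, v, w} = UNIV" by auto
  show expand: "x = g x u' *\<^sub>R u + g x v' *\<^sub>R v + g x w' *\<^sub>R w" for x
  proof -
    obtain a b c where "x = a *\<^sub>R u + b *\<^sub>R v + c *\<^sub>R w" using span span_three by blast
    with coeff[of a b c] show ?thesis by simp
  qed
  show "dual_frame g {0, 1, 2::nat} (\<lambda>i. [u, v, w] ! i) (\<lambda>i. [u', v', w'] ! i)"
    unfolding dual_frame_def using expand by (auto simp: add.assoc)
qed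

lemma trace_dual_triples:
  fixes g :: "'a::euclidean_space \<Rightarrow> 'a \<Rightarrow> real"
  assumes g: "bilinear g" and dim: "DIM('a) = 3" and d: "dual_triples g u v w u' v' w'" and f: "linear f"
  shows "trace_on UNIV f = g (f u) u' + g (f v) v' + g (f w) w'"
proof -
  have "trace_on UNIV f = (\<Sum>i\<in>{0, 1, 2::nat}. g (f ([u, v, w] ! i)) ([u', v', w'] ! i))"
    using dual_triples_basis(4)[OF g dim d] g f
    by (intro trace_on_frame) (auto simp: dual_frame_def bilinear_def)
  then show ?thesis by (simp add: add.assoc)
qed

lemma linear_trace_ad:
  assumes br: "bilinear br"
  shows "linear (trace_ad (br :: 'a::euclidean_space \<Rightarrow> 'a \<Rightarrow> 'a))"
proof -
  have "trace_ad br x = (\<Sum>b\<in>Basis. br x b \<bullet> b)" for x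
    unfolding trace_ad_def using br
    by (intro trace_on_frame)
      (auto simp: bilinear_def euclidean_representation intro!: linearI inner_add_left)
  then have "trace_ad br = (\<lambda>x. \<Sum>b\<in>Basis. br x b \<bullet> b)" by blast
  then show ?thesis
    by (auto intro!: linearI simp: bilinear_ladd[OF br] bilinear_lmul[OF br] inner_add_left
        sum.distrib sum_distrib_left)
qed

text \<open>Let \<open>t\<close> be the vector with \<open>\<tau> x = g x t\<close>. The kernel of
  \<open>\<tau>\<close> is the orthogonal complement of \<open>t\<close>: nondegenerate if
  \<open>t\<close> is nonnull, and containing \<open>t\<close> itself if \<open>t\<close> is null.
  These are the two alternatives.\<close>

lemma adapted_frame_exists:
  fixes g :: "'a::euclidean_space \<Rightarrow> 'a \<Rightarrow> real"
  assumes g: "scalar_product g" and dim: "DIM('a) = 3"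
    and \<tau>: "linear \<tau>" and nz: "\<tau> x0 \<noteq> (0::real)"
  shows "(\<exists>v1 v2 v3. \<bar>g v1 v1\<bar> = 1 \<and> \<bar>g v2 v2\<bar> = 1 \<and> \<bar>g v3 v3\<bar> = 1 \<and>
            g v1 v2 = 0 \<and> g v1 v3 = 0 \<and> g v2 v3 = 0 \<and> \<tau> v1 = 0 \<and> \<tau> v2 \<noteq> 0 \<and> \<tau> v3 = 0) \<or>
         (\<exists>v1 v2 v3. g v1 v1 = 0 \<and> g v1 v2 = 1 \<and> g v2 v2 = 0 \<and> g v1 v3 = 0 \<and> g v2 v3 = 0 \<and>
            \<bar>g v3 v3\<bar> = 1 \<and> \<tau> v1 = 0 \<and> \<tau> v2 \<noteq> 0 \<and> \<tau> v3 = 0)"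
proof -
  have lin: "linear (g x)" "linear (\<lambda>x. g x y)" and sym: "g x y = g y x"
    and nd: "(\<And>y. g x y = 0) \<Longrightarrow> x = 0" and bil: "bilinear g" for x y
    using g by (auto simp: scalar_product_def bilinear_def nondegenerate_on_def)
  note lin_simps = linear_add[OF lin(1)] linear_add[OF lin(2)] linear_scale[OF lin(1)]
    linear_scale[OF lin(2)] linear_diff[OF lin(1)] linear_diff[OF lin(2)]
  have next_vector: "\<exists>w. \<bar>g w w\<bar> = 1 \<and> (\<forall>s\<in>S. g w s = 0)"
    if "finite S" "card S < 3" "\<And>s. s \<in> S \<Longrightarrow> g s s \<noteq> 0"
      "\<And>s t. s \<in> S \<Longrightarrow> t \<in> S \<Longrightarrow> s \<noteq> t \<Longrightarrow> g s t = 0" for S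
  proof -
    have "card S < DIM('a)" using that dim by simp
    from nonnull_orthogonal_exists[OF g that(1) this that(3,4)]
    obtain w where w: "g w w \<noteq> 0" "\<forall>s\<in>S. g w s = 0" by blast
    define r where "r = 1 / sqrt \<bar>g w w\<bar>"
    have r2: "r * r = 1 / \<bar>g w w\<bar>" by (simp add: r_def)
    have "g (r *\<^sub>R w) (r *\<^sub>R w) = (r * r) * g w w" by (simp add: lin_simps)
    then have "\<bar>g (r *\<^sub>R w) (r *\<^sub>R w)\<bar> = 1"
      using w by (simp add: r2 abs_mult)
    moreover have "\<forall>s\<in>S. g (r *\<^sub>R w) s = 0" using w by (simp add: lin_simps)
    ultimately show ?thesis by blast
  qed
  obtain a where a: "\<bar>g a a\<bar> = 1" using next_vector[of "{}"] by auto
  obtain b where b: "\<bar>g b b\<bar> = 1" "g b a = 0" using next_vector[of "{a}"] a by fastforce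
  obtain c where c: "\<bar>g c c\<bar> = 1" "g c a = 0" "g c b = 0"
  proof -
    have "a \<noteq> b" using a b by auto
    then show thesis using next_vector[of "{a, b}"] a b that sym by fastforce
  qed
  have "dual_triples g a b c (g a a *\<^sub>R a) (g b b *\<^sub>R b) (g c c *\<^sub>R c)"
    using a b c by (auto simp: dual_triples_def lin_simps sym[of a b] sym[of a c] sym[of b c]
        abs_mult_self_eq simp flip: power2_eq_square dest: arg_cong[of _ _ "\<lambda>x. x\<^sup>2"])
  note expand = dual_triples_basis(3)[OF bil dim this]
  \<comment> \<open>The index of \<open>\<tau>\<close> is raised in an auxiliary orthonormal frame,
    hence the signs \<open>g a a\<close>, \<open>g b b\<close>, \<open>g c c\<close>.\<close>
  define t where "t = \<tau> a *\<^sub>R (g a a *\<^sub>R a) + \<tau> b *\<^sub>R (g b b *\<^sub>R b) + \<tau> c *\<^sub>R (g c c *\<^sub>R c)"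
  have t: "\<tau> x = g x t" for x
  proof -
    have "\<tau> x = \<tau> (g x (g a a *\<^sub>R a) *\<^sub>R a + g x (g b b *\<^sub>R b) *\<^sub>R b + g x (g c c *\<^sub>R c) *\<^sub>R c)"
      using expand[of x] by simp
    then show ?thesis
      by (simp add: t_def linear_add[OF \<tau>] linear_scale[OF \<tau>] lin_simps algebra_simps)
  qed
  show ?thesis
  proof (cases "g t t = 0")
    case False
    define r where "r = 1 / sqrt \<bar>g t t\<bar>"
    have r2: "r * r = 1 / \<bar>g t t\<bar>" and r0: "r \<noteq> 0" using False by (auto simp: r_def)
    define v2 where "v2 = r *\<^sub>R t"
    have v2: "\<bar>g v2 v2\<bar> = 1" "\<tau> v2 \<noteq> 0"
      using False r0 by (auto simp: v2_def lin_simps t r2 abs_mult simp flip: mult.assoc)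
    have \<tau>v2: "\<tau> x = 0" if "g x v2 = 0" for x using that r0 by (auto simp: v2_def lin_simps t)
    obtain v1 where v1: "\<bar>g v1 v1\<bar> = 1" "g v1 v2 = 0" using next_vector[of "{v2}"] v2 by fastforce
    obtain v3 where v3: "\<bar>g v3 v3\<bar> = 1" "g v3 v1 = 0" "g v3 v2 = 0"
    proof -
      have "v1 \<noteq> v2" using v1 v2 by auto
      then show thesis using next_vector[of "{v1, v2}"] v1 v2 that sym by fastforce
    qed
    show ?thesis
      using v1 v2 v3 \<tau>v2[OF v1(2)] \<tau>v2[OF v3(3)] sym by metis
  next
    case True
    obtain w where w: "g t w \<noteq> 0" using nd[of t] nz t sym by (metis)
    \<comment> \<open>Completion of \<open>t\<close> to a hyperbolic pair: \<open>s\<close> is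
      scaled to \<open>g t s = 1\<close>, and subtracting \<open>g s s / 2\<close> times
      \<open>t\<close> makes it null without changing its product with the null vector
      \<open>t\<close>.\<close>
    define s where "s = (1 / g t w) *\<^sub>R w"
    define v2 where "v2 = s - (g s s / 2) *\<^sub>R t"
    have s: "g t s = 1" "g s t = 1" using w by (auto simp: s_def lin_simps sym[of w t])
    have v2: "g t v2 = 1" "g v2 t = 1" "g v2 v2 = 0"
      using True s by (auto simp: v2_def lin_simps)
    \<comment> \<open>\<open>next_vector\<close> wants nonnull vectors, so the null pair is replaced
      by its sum and difference.\<close>
    define p q where "p = t + v2" and "q = t - v2"
    have pq: "g p p = 2" "g q q = - 2" "g p q = 0" "g q p = 0"
      using v2 True by (auto simp: lin_simps p_def q_def)
    obtain v3 where v3: "\<bar>g v3 v3\<bar> = 1" "g v3 p = 0" "g v3 q = 0"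
    proof -
      have "p \<noteq> q" using pq by auto
      then show thesis using next_vector[of "{p, q}"] pq that by fastforce
    qed
    then have "g v3 t = 0" "g v3 v2 = 0" by (auto simp: lin_simps p_def q_def)
    then show ?thesis
      using v3 v2 True t sym by (intro disjI2 exI[of _ t] exI[of _ v2] exI[of _ v3]) auto
  qed
qed

section \<open>Divergence-free Einstein structures\<close>

lemma lie_algebra_bilinear: "lie_algebra br \<Longrightarrow> bilinear br"
  and lie_algebra_alt: "lie_algebra br \<Longrightarrow> br x x = 0"
  by (auto simp: lie_algebra_def)

lemma lie_algebra_skew: "lie_algebra br \<Longrightarrow> br y x = - br x y"
  by (auto simp: lie_algebra_def intro: bilinear_alt_skew)

text \<open>The vanishing traces of \<open>ad v1\<close> and \<open>ad v3\<close> give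
  \<open>a2 = p3\<close> and \<open>b2 = - p1\<close>. With these the Jacobi identity collapses to
  the trace \<open>a1 + b3\<close> of \<open>ad v2\<close> times \<open>[v1, v3]\<close>, so
  \<open>[v1, v3] = 0\<close>; then \<open>a2\<close> and \<open>b2\<close> vanish too.\<close>

lemma nonunimodular_structure:
  fixes g :: "'a::euclidean_space \<Rightarrow> 'a \<Rightarrow> real"
  assumes L: "lie_algebra br" and g: "bilinear g" and dim: "DIM('a) = 3"
    and d: "dual_triples g v1 v2 v3 v1' v2' v3'"
    and tr: "trace_ad br v1 = 0" "trace_ad br v2 \<noteq> 0" "trace_ad br v3 = 0"
  obtains a b c d where "br v1 v3 = 0" "br v2 v1 = a *\<^sub>R v1 + b *\<^sub>R v3"
    "br v2 v3 = c *\<^sub>R v1 + d *\<^sub>R v3" "a + d \<noteq> 0"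
proof -
  note br = lie_algebra_bilinear[OF L]
  have lin: "linear (g x)" "linear (\<lambda>x. g x y)" "linear (br x)" for x y
    using g br by (auto simp: bilinear_def)
  note expand = dual_triples_basis(3)[OF g dim d]
  have trace: "trace_ad br x = g (br x v1) v1' + g (br x v2) v2' + g (br x v3) v3'" for x
    unfolding trace_ad_def by (rule trace_dual_triples[OF g dim d lin(3)])
  define P A B where "P = br v1 v3" and "A = br v2 v1" and "B = br v2 v3"
  have brs: "br v1 v2 = - A" "br v3 v1 = - P" "br v3 v2 = - B" "br v1 v3 = P" "br v2 v1 = A"
    "br v2 v3 = B" "\<And>x. br x x = 0"
    by (auto simp: P_def A_def B_def lie_algebra_alt[OF L] intro: lie_algebra_skew[OF L])
  define p1 p2 p3 where "p1 = g P v1'" and "p2 = g P v2'" and "p3 = g P v3'"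
  define a1 a2 a3 where "a1 = g A v1'" and "a2 = g A v2'" and "a3 = g A v3'"
  define b1 b2 b3 where "b1 = g B v1'" and "b2 = g B v2'" and "b3 = g B v3'"
  have P: "P = p1 *\<^sub>R v1 + p2 *\<^sub>R v2 + p3 *\<^sub>R v3" unfolding p1_def p2_def p3_def by (rule expand)
  have A: "A = a1 *\<^sub>R v1 + a2 *\<^sub>R v2 + a3 *\<^sub>R v3" unfolding a1_def a2_def a3_def by (rule expand)
  have B: "B = b1 *\<^sub>R v1 + b2 *\<^sub>R v2 + b3 *\<^sub>R v3" unfolding b1_def b2_def b3_def by (rule expand)
  have t: "a2 = p3" "p1 = - b2" "a1 + b3 \<noteq> 0"
    using tr unfolding trace brs
    by (simp_all add: linear_neg[OF lin(2)] linear_0[OF lin(2)] a1_def a2_def b2_def b3_def p1_def p3_def)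
  have b_simps: "br x (r *\<^sub>R y + s *\<^sub>R y' + q *\<^sub>R z) = r *\<^sub>R br x y + s *\<^sub>R br x y' + q *\<^sub>R br x z"
    for x y y' z r s q
    by (simp add: bilinear_radd[OF br] bilinear_rmul[OF br])
  have "0 = br v1 B + br v2 (- P) + br v3 (- A)"
    using L brs unfolding lie_algebra_def by metis
  also have "\<dots> = br v1 B - br v2 P - br v3 A"
    by (simp add: linear_neg[OF lin(3)])
  also have "br v1 B = b3 *\<^sub>R P - b2 *\<^sub>R A" by (subst B) (simp add: b_simps brs)
  also have "br v2 P = p1 *\<^sub>R A + p3 *\<^sub>R B" by (subst P) (simp add: b_simps brs)
  also have "br v3 A = - (a1 *\<^sub>R P) - a2 *\<^sub>R B" by (subst A) (simp add: b_simps brs)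
  finally have "(a1 + b3) *\<^sub>R P = 0" by (simp add: t algebra_simps)
  then have P0: "P = 0" using t by simp
  then have "a2 = 0" "b2 = 0" using t by (auto simp: p1_def p3_def linear_0[OF lin(2)])
  then show thesis using that[of a1 a3 b1 b3] P0 brs A B t by simp
qed

text \<open>The normal form of the theorem; \<open>t\<close> is its constant \<theta>, and
  \<open>\<epsilon>\<close> leaves the overall sign of \<open>g\<close> open.\<close>

definition soliton_frame ::
    "('a::real_vector \<Rightarrow> 'a \<Rightarrow> 'a) \<Rightarrow> ('a \<Rightarrow> 'a \<Rightarrow> real) \<Rightarrow> 'a \<Rightarrow> 'a \<Rightarrow> 'a \<Rightarrow> real \<Rightarrow> real \<Rightarrow> bool" where
  "soliton_frame br g v1 v2 v3 t \<epsilon> \<longleftrightarrow>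
     g v1 v2 = 0 \<and> g v1 v3 = 0 \<and> g v2 v3 = 0 \<and>
     g v1 v1 = \<epsilon> \<and> g v2 v2 = \<epsilon> \<and> g v3 v3 = - \<epsilon> \<and> \<bar>\<epsilon>\<bar> = 1 \<and> t > 0 \<and>
     br v1 v3 = 0 \<and> br v2 v1 = t *\<^sub>R v1 - t *\<^sub>R v3 \<and> br v2 v3 = t *\<^sub>R v1 + t *\<^sub>R v3"

lemma orthonormal_dual_triples:
  fixes g :: "'a::real_vector \<Rightarrow> 'a \<Rightarrow> real"
  assumes "bilinear g" "\<And>x y. g x y = g y x" "g u v = 0" "g u w = 0" "g v w = 0"
    "\<bar>g u u\<bar> = 1" "\<bar>g v v\<bar> = 1" "\<bar>g w w\<bar> = 1"
  shows "dual_triples g u v w (g u u *\<^sub>R u) (g v v *\<^sub>R v) (g w w *\<^sub>R w)"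
proof -
  have sq: "r * r = 1" if "\<bar>r\<bar> = 1" for r :: real using that by (auto simp: abs_if split: if_splits)
  show ?thesis
    using assms sq by (auto simp: dual_triples_def bilinear_rmul[OF assms(1)])
qed

lemma einstein_triple_equation:
  fixes g :: "'a::euclidean_space \<Rightarrow> 'a \<Rightarrow> real"
  assumes L: "lie_algebra br" and dim: "DIM('a) = 3" and E: "generalized_einstein br H g (\<lambda>_. 0)"
    and d: "dual_triples g v1 v2 v3 v1' v2' v3'"
  shows "(let T = \<lambda>a a' b b'. (H a x b' - koszul br g a x b') * (H b y a' + koszul br g b y a');
              S = \<lambda>a a'. T a a' v1 v1' + T a a' v2 v2' + T a a' v3 v3'
          in S v1 v1' + S v2 v2' + S v3 v3') = 0"
proof -
  have H: "three_form H" and g: "scalar_product g" using E by (auto simp: generalized_einstein_def)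
  obtain D where D: "gen_levi_civita br H g D" "\<And>w. gen_divergence D w = 0"
    "\<And>u w. u \<in> E_minus g \<Longrightarrow> w \<in> E_plus g \<Longrightarrow> gen_ric_plus br H g D u w = 0"
    using E by (auto simp: generalized_einstein_def)
  have bil: "bilinear g" using g by (simp add: scalar_product_def)
  interpret metric_frame g "{0, 1, 2::nat}" "\<lambda>i. [v1, v2, v3] ! i" "\<lambda>i. [v1', v2', v3'] ! i"
    using g dual_triples_basis(4)[OF bil dim d] by unfold_locales
  show ?thesis
    using einstein_frame_equation[OF lie_algebra_bilinear[OF L] lie_algebra_alt[OF L] H D, of x y]
    by (simp add: add.assoc)
qed

lemma three_form_eq_0:
  fixes H :: "'a::real_vector \<Rightarrow> 'a \<Rightarrow> 'a \<Rightarrow> real"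
  assumes H: "three_form H" and span: "span {u, v, w} = UNIV" and "H u v w = 0"
  shows "H x y z = 0"
proof -
  have lin: "linear (H x y)" "linear (\<lambda>x. H x y z)" "linear (\<lambda>y. H x y z)" for x y z
    using H by (auto simp: three_form_def)
  have alt: "H x x y = 0" "H x y y = 0" "H x y x = 0" for x y
    using H by (auto simp: three_form_def)
  have "H v u w = 0" "H u w v = 0"
    using assms(3) three_form_skew(1)[OF H, where x = u and y = v and z = w]
      three_form_skew(2)[OF H, where x = u and y = v and z = w] by simp_all
  moreover from this have "H v w u = 0" "H w u v = 0"
    using three_form_skew(2)[OF H, where x = v and y = u and z = w]
      three_form_skew(1)[OF H, where x = u and y = w and z = v] by simp_all
  moreover from this have "H w v u = 0"
    using three_form_skew(1)[OF H, where x = v and y = w and z = u] by simp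
  ultimately have perm: "H u v w = 0" "H v u w = 0" "H u w v = 0" "H v w u = 0" "H w u v = 0"
    "H w v u = 0" using assms(3) by simp_all
  have base: "H a b c = 0" if "a \<in> {u, v, w}" "b \<in> {u, v, w}" "c \<in> {u, v, w}" for a b c
    using that perm alt by auto
  have all: "z \<in> span {u, v, w}" for z using span by simp
  have 1: "H a b z = 0" if ab: "a \<in> {u, v, w}" "b \<in> {u, v, w}" for a b z
    by (rule linear_eq_0_on_span[OF lin(1) base[OF ab] all])
  have 2: "H a y z = 0" if a: "a \<in> {u, v, w}" for a y z
    by (rule linear_eq_0_on_span[OF lin(3) 1[OF a] all])
  show ?thesis
    by (rule linear_eq_0_on_span[OF lin(2) 2 all])
qed

lemma koszul_scale:
  assumes "bilinear br" "bilinear g"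
  shows "koszul br g x y (r *\<^sub>R z) = r * koszul br g x y z"
  by (simp add: koszul_def bilinear_lmul[OF assms(1)] bilinear_rmul[OF assms(1)]
      bilinear_lmul[OF assms(2)] bilinear_rmul[OF assms(2)] algebra_simps)

lemma three_form_scale:
  "three_form H \<Longrightarrow> H x y (r *\<^sub>R z) = r * H x y z"
  by (simp add: three_form_def linear_scale)

lemma three_form_table:
  assumes H: "three_form H"
  shows "H v1 v3 v2 = - H v1 v2 v3" "H v2 v1 v3 = - H v1 v2 v3" "H v2 v3 v1 = H v1 v2 v3"
    "H v3 v1 v2 = H v1 v2 v3" "H v3 v2 v1 = - H v1 v2 v3"
proof -
  note skew = three_form_skew[OF H]
  show 1: "H v1 v3 v2 = - H v1 v2 v3" by (rule skew(2))
  show 2: "H v2 v1 v3 = - H v1 v2 v3" by (rule skew(1))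
  show 3: "H v2 v3 v1 = H v1 v2 v3" using skew(2)[where x = v2 and y = v1 and z = v3] 2 by simp
  show 4: "H v3 v1 v2 = H v1 v2 v3" using skew(1)[where x = v1 and y = v3 and z = v2] 1 by simp
  show "H v3 v2 v1 = - H v1 v2 v3" using skew(2)[where x = v3 and y = v1 and z = v2] 4 by simp
qed

section \<open>The frame equations solved for the structure constants\<close>

context
  fixes br :: "'a::euclidean_space \<Rightarrow> 'a \<Rightarrow> 'a" and H g v1 v2 v3 a b c d
  assumes L: "lie_algebra br" and dim: "DIM('a) = 3" and E: "generalized_einstein br H g (\<lambda>_. 0)"
    and br13: "br v1 v3 = 0" and br21: "br v2 v1 = a *\<^sub>R v1 + b *\<^sub>R v3"
    and br23: "br v2 v3 = c *\<^sub>R v1 + d *\<^sub>R v3"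
begin

lemma bracket_table:
  "br v3 v1 = 0" "br v1 v2 = - (a *\<^sub>R v1 + b *\<^sub>R v3)" "br v3 v2 = - (c *\<^sub>R v1 + d *\<^sub>R v3)"
  using lie_algebra_skew[OF L] br13 br21 br23 by (metis neg_0_equal_iff_equal)+

text \<open>Exchanging \<open>v1\<close> and \<open>v3\<close> exchanges \<open>b\<close> with
  \<open>c\<close>, so the equation at \<open>(v3, v3)\<close> is the one at \<open>(v1, v1)\<close>
  with \<open>c\<^sup>2 - b\<^sup>2\<close> reversed in sign. The third relation is the equation at
  \<open>(v2, v2)\<close>.\<close>

lemma einstein_orthonormal:
  assumes e: "g v1 v1 = e1" "g v2 v2 = e2" "g v3 v3 = e3" "\<bar>e1\<bar> = 1" "\<bar>e2\<bar> = 1" "\<bar>e3\<bar> = 1"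
    and orth: "g v1 v2 = 0" "g v1 v3 = 0" "g v2 v3 = 0"
  shows "c\<^sup>2 - b\<^sup>2 = (H v1 v2 v3)\<^sup>2" "b\<^sup>2 - c\<^sup>2 = (H v1 v2 v3)\<^sup>2"
    "2 * (a\<^sup>2 + d\<^sup>2) + 2 * b * c + e1 * e3 * (b\<^sup>2 + c\<^sup>2 + (H v1 v2 v3)\<^sup>2) = 0"
proof -
  have H: "three_form H" and g: "bilinear g" "\<And>x y. g x y = g y x"
    using E by (auto simp: generalized_einstein_def scalar_product_def)
  have alt: "\<And>x y. H x x y = 0" "\<And>x y. H x y y = 0" "\<And>x y. H x y x = 0"
    using H by (auto simp: three_form_def)
  have orth': "g v2 v1 = 0" "g v3 v1 = 0" "g v3 v2 = 0" using orth g(2) by metis+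
  have lin: "g (x + y) z = g x z + g y z" "g (r *\<^sub>R x) z = r * g x z" "g (- x) z = - g x z" "g 0 z = 0"
    "g z 0 = 0" "g (x - y) z = g x z - g y z" for x y z r
    by (simp_all add: bilinear_ladd[OF g(1)] bilinear_lmul[OF g(1)] bilinear_lneg[OF g(1)]
        bilinear_lzero[OF g(1)] bilinear_rzero[OF g(1)] bilinear_lsub[OF g(1)])
  have dual: "dual_triples g v1 v2 v3 (e1 *\<^sub>R v1) (e2 *\<^sub>R v2) (e3 *\<^sub>R v3)"
    using orthonormal_dual_triples[OF g orth] e by simp
  note eq = einstein_triple_equation[OF L dim E dual]
  note table = three_form_table[OF H, where ?v1.0 = v1 and ?v2.0 = v2 and ?v3.0 = v3] alt
    koszul_scale[OF lie_algebra_bilinear[OF L] g(1)]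
    three_form_scale[OF H] koszul_def br13 br21 br23 bracket_table lie_algebra_alt[OF L]
    bilinear_rmul[OF lie_algebra_bilinear[OF L]]
    bilinear_lmul[OF lie_algebra_bilinear[OF L]] bilinear_rmul[OF g(1)] e orth orth' lin
  have sq: "e1 * e1 = 1" "e2 * e2 = 1" "e3 * e3 = 1"
    using e by (auto simp: abs_if split: if_splits)
  define h where "h = H v1 v2 v3"
  note table = table h_def[symmetric]
  have eq11: "(- (e3 * h) - (b * (e3 * e3) - e3 * (c * e1))) *
      (e2 * h + (e2 * (b * e3) + e2 * (c * e1))) +
      (e2 * h - (e2 * (c * e1) + e2 * (b * e3))) *
      (e3 * (b * e3) - e3 * (c * e1) - e3 * h) =
      0"
    using eq[of v1 v1] by (simp add: Let_def table)
  have eq22: "(e3 * h - (- (b * (e3 * e3)) - e3 * (c * e1))) *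
      (- (e1 * (c * e1)) - e1 * (b * e3) - e1 * h) -
      4 * (a * (e1 * (e1 * (a * (e1 * e1))))) +
      ((- (e1 * h) - (- (c * (e1 * e1)) - e1 * (b * e3))) *
       (e3 * h + (- (e3 * (b * e3)) - e3 * (c * e1))) -
       4 * (d * (e3 * (e3 * (d * (e3 * e3)))))) =
      0"
    using eq[of v2 v2] by (simp add: Let_def table)
  have eq33: "(- (e2 * h) - (e2 * (b * e3) + e2 * (c * e1))) *
      (e1 * h + (e1 * (c * e1) - e1 * (b * e3))) +
      (e1 * h - (c * (e1 * e1) - e1 * (b * e3))) *
      (e2 * (c * e1) + e2 * (b * e3) - e2 * h) =
      0"
    using eq[of v3 v3] by (simp add: Let_def table)
  \<comment> \<open>The signs stay symbolic and are reduced modulo \<open>sq\<close>, so one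
    computation covers all signatures.\<close>
  have "c\<^sup>2 - b\<^sup>2 = h\<^sup>2" using eq11 sq by algebra
  moreover have "b\<^sup>2 - c\<^sup>2 = h\<^sup>2" using eq33 sq by algebra
  moreover have "2 * (a\<^sup>2 + d\<^sup>2) + 2 * b * c + e1 * e3 * (b\<^sup>2 + c\<^sup>2 + h\<^sup>2) = 0"
    using eq22 sq by algebra
  ultimately show "c\<^sup>2 - b\<^sup>2 = (H v1 v2 v3)\<^sup>2" "b\<^sup>2 - c\<^sup>2 = (H v1 v2 v3)\<^sup>2"
    "2 * (a\<^sup>2 + d\<^sup>2) + 2 * b * c + e1 * e3 * (b\<^sup>2 + c\<^sup>2 + (H v1 v2 v3)\<^sup>2) = 0"
    by (simp_all add: h_def)
qed

text \<open>Excludes a degenerate kernel: in a null frame the relevant equations become sums of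
  squares, and the trace \<open>a + d\<close> of \<open>ad v2\<close> would vanish.\<close>

lemma einstein_null_frame:
  assumes e: "g v1 v1 = 0" "g v1 v2 = 1" "g v2 v2 = 0" "g v1 v3 = 0" "g v2 v3 = 0" "g v3 v3 = e" "\<bar>e\<bar> = 1"
  shows "a = 0" "d = 0"
proof -
  have H: "three_form H" and g: "bilinear g" "\<And>x y. g x y = g y x"
    using E by (auto simp: generalized_einstein_def scalar_product_def)
  have alt: "\<And>x y. H x x y = 0" "\<And>x y. H x y y = 0" "\<And>x y. H x y x = 0"
    using H by (auto simp: three_form_def)
  have e': "g v2 v1 = 1" "g v3 v1 = 0" "g v3 v2 = 0" using e g(2) by metis+
  have lin: "g (x + y) z = g x z + g y z" "g (r *\<^sub>R x) z = r * g x z" "g (- x) z = - g x z" "g 0 z = 0"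
    "g z 0 = 0" "g (x - y) z = g x z - g y z" "g z (r *\<^sub>R x) = r * g z x" for x y z r
    by (simp_all add: bilinear_ladd[OF g(1)] bilinear_lmul[OF g(1)] bilinear_lneg[OF g(1)]
        bilinear_lzero[OF g(1)] bilinear_rzero[OF g(1)] bilinear_lsub[OF g(1)] bilinear_rmul[OF g(1)])
  have sq: "e = 1 \<or> e = - 1" using e by (auto simp: abs_if split: if_splits)
  then have dual: "dual_triples g v1 v2 v3 v2 v1 (e *\<^sub>R v3)"
    using e e' by (auto simp: dual_triples_def lin)
  note eq = einstein_triple_equation[OF L dim E dual]
  note table = three_form_table[OF H, where ?v1.0 = v1 and ?v2.0 = v2 and ?v3.0 = v3] alt
    koszul_scale[OF lie_algebra_bilinear[OF L] g(1)]
    three_form_scale[OF H] koszul_def br13 br21 br23 bracket_table lie_algebra_alt[OF L]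
    bilinear_rmul[OF lie_algebra_bilinear[OF L]]
    bilinear_lmul[OF lie_algebra_bilinear[OF L]] e e' lin
  have "2 * (b * b) + 2 * (H v1 v2 v3 * H v1 v2 v3) = 0"
    using eq[of v1 v2] sq
    by (simp add: Let_def table; elim disjE; simp add: power2_eq_square algebra_simps; linarith?)
  then have "b * b + H v1 v2 v3 * H v1 v2 v3 = 0" by linarith
  then have b: "b = 0" by simp
  \<comment> \<open>The only other term of this equation is a multiple of \<open>b * c\<close>,
    which is why \<open>b = 0\<close> comes first.\<close>
  have "4 * (a * a) + 4 * (d * d) = 0"
    using eq[of v2 v2] sq b
    by (simp add: Let_def table; elim disjE; simp add: power2_eq_square algebra_simps; linarith?)
  then have "a * a + d * d = 0" by linarith
  then show "a = 0" "d = 0" by simp_all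
qed

end

text \<open>The boost with matrix rows \<open>(p, q)\<close>, \<open>(q, p)\<close> in the Lorentzian plane spanned by \<open>v1\<close> and \<open>v3\<close>
  makes the trace-free symmetric part of the action of \<open>v2\<close> off-diagonal.\<close>

lemma boost_normal_form_aux:
  fixes g :: "'a::real_vector \<Rightarrow> 'a \<Rightarrow> real"
  assumes br: "bilinear br" "\<And>x. br x x = 0" and g: "bilinear g" "\<And>x y. g x y = g y x"
    and orth: "g v1 v2 = 0" "g v1 v3 = 0" "g v2 v3 = 0"
    and e: "g v1 v1 = \<epsilon>" "g v2 v2 = \<epsilon>" "g v3 v3 = - \<epsilon>" "\<bar>\<epsilon>\<bar> = 1"
    and brs: "br v1 v3 = 0" "br v2 v1 = a *\<^sub>R v1 + b *\<^sub>R v3" "br v2 v3 = - b *\<^sub>R v1 + d *\<^sub>R v3"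
    and m: "a + d > 0" and b: "b < 0" and q: "a\<^sup>2 + d\<^sup>2 = 2 * b\<^sup>2"
  shows "\<exists>w1 w2 w3 t. soliton_frame br g w1 w2 w3 t \<epsilon>"
proof -
  define m s where "m = (a + d) / 2" and "s = (a - d) / 2"
  have a: "a = m + s" and d: "d = m - s" by (auto simp: m_def s_def field_simps)
  have m0: "m > 0" using m by (simp add: m_def)
  have sq: "s\<^sup>2 = b\<^sup>2 - m\<^sup>2" using q by (simp add: a d power2_eq_square algebra_simps)
  \<comment> \<open>\<open>p\<close> and \<open>r\<close> are cosh and sinh of the boost parameter
    whose double has cosh \<open>- b / m\<close> and sinh \<open>- s / m\<close>; \<open>sq\<close>
    makes these compatible, and the half-angle formula gives \<open>p\<close>. The trace-free part,
    with entries \<open>s\<close> and \<open>b\<close>, is moved to \<open>0\<close> and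
    \<open>- m\<close>, which needs \<open>b < 0 < m\<close>.\<close>
  define p where "p = sqrt ((m - b) / (2 * m))"
  define r where "r = - s / (2 * m * p)"
  have p2: "p * p = (m - b) / (2 * m)" and p0: "p > 0"
    using m0 b by (auto simp: p_def)
  have pr: "p * r = - s / (2 * m)" using p0 m0 by (simp add: r_def)
  \<comment> \<open>This relation and the next are hyperbolic double-angle identities, multiplied by
    \<open>p\<close> so that only \<open>p * p\<close> and \<open>p * r\<close> occur.\<close>
  have "p * (s * p - r * (b - m)) = s * (p * p) - (p * r) * (b - m)" by (simp add: algebra_simps)
  also have "\<dots> = 0" unfolding p2 pr using m0 by (simp add: field_simps)
  finally have A1: "s * p = r * (b - m)" using p0 by simp
  have "p * (p * (b + m) - s * r) = (p * p) * (b + m) - s * (p * r)" by (simp add: algebra_simps)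
  also have "\<dots> = ((m - b) * (b + m) + s\<^sup>2) / (2 * m)"
    unfolding p2 pr using m0 by (simp add: field_simps power2_eq_square)
  also have "\<dots> = 0" unfolding sq by (simp add: power2_eq_square algebra_simps)
  finally have "p * (b + m) = s * r" using p0 by simp
  note A = A1 this
  have "(p * p) * (p * p - r * r) = (p * p) * 1"
  proof -
    have "(p * p) * (p * p - r * r) = (p * p)\<^sup>2 - (p * r)\<^sup>2" by (simp add: power2_eq_square algebra_simps)
    also have "\<dots> = ((m - b)\<^sup>2 - s\<^sup>2) / (2 * m)\<^sup>2"
      unfolding p2 pr by (simp only: power_divide power2_minus) (simp only: diff_divide_distrib)
    also have "(m - b)\<^sup>2 - s\<^sup>2 = (2 * m) * (m - b)"
      unfolding sq by (simp add: power2_eq_square algebra_simps)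
    also have "(2 * m) * (m - b) / (2 * m)\<^sup>2 = (p * p) * 1"
      unfolding p2 using m0 by (simp add: power2_eq_square field_simps)
    finally show ?thesis .
  qed
  then have pr1: "p * p - r * r = 1" using p0 by (metis mult_left_cancel mult_pos_pos less_irrefl)
  define w1 w3 where "w1 = p *\<^sub>R v1 + r *\<^sub>R v3" and "w3 = r *\<^sub>R v1 + p *\<^sub>R v3"
  have br31: "br v3 v1 = 0" using bilinear_alt_skew[OF br, of v3 v1] brs by simp
  have orth': "g v2 v1 = 0" "g v3 v1 = 0" "g v3 v2 = 0" using orth g(2) by metis+
  have br2: "br v2 (x *\<^sub>R v1 + y *\<^sub>R v3) = (x * a - y * b) *\<^sub>R v1 + (x * b + y * d) *\<^sub>R v3" for x y
    by (simp add: bilinear_radd[OF br(1)] bilinear_rmul[OF br(1)] brs algebra_simps)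
  have "p * a - r * b = m * (p - r)" "p * b + r * d = m * (r - p)"
    "r * a - p * b = m * (p + r)" "r * b + p * d = m * (p + r)"
    using A by (auto simp: a d algebra_simps)
  then have "br v2 w1 = m *\<^sub>R w1 - m *\<^sub>R w3" "br v2 w3 = m *\<^sub>R w1 + m *\<^sub>R w3"
    by (simp_all only: w1_def w3_def br2) (simp_all add: algebra_simps)
  moreover have "br w1 w3 = 0"
    by (simp add: w1_def w3_def bilinear_ladd[OF br(1)] bilinear_radd[OF br(1)] bilinear_lmul[OF br(1)]
        bilinear_rmul[OF br(1)] brs br31 br(2))
  moreover have "g w1 v2 = 0" "g v2 w3 = 0" "g w1 w3 = 0"
    by (simp_all add: w1_def w3_def bilinear_ladd[OF g(1)] bilinear_radd[OF g(1)] bilinear_lmul[OF g(1)]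
        bilinear_rmul[OF g(1)] orth orth' e)
  moreover have "g w1 w1 = (p * p - r * r) * \<epsilon>" "g w3 w3 = - ((p * p - r * r) * \<epsilon>)"
    by (simp_all add: w1_def w3_def bilinear_ladd[OF g(1)] bilinear_radd[OF g(1)] bilinear_lmul[OF g(1)]
        bilinear_rmul[OF g(1)] orth orth' e algebra_simps)
  ultimately have "soliton_frame br g w1 v2 w3 m \<epsilon>"
    unfolding soliton_frame_def pr1 using e m0 by simp
  then show ?thesis by blast
qed

text \<open>Reduction of signs: \<open>\<sigma>\<close> reverses \<open>v2\<close> if the trace is
  negative, and \<open>\<rho>\<close> then reverses \<open>v3\<close> if needed to make the
  off-diagonal entry negative. \<open>b\<close> is nonzero because otherwise \<open>q\<close> would
  give \<open>a = d = 0\<close>.\<close>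

lemma boost_normal_form:
  fixes g :: "'a::real_vector \<Rightarrow> 'a \<Rightarrow> real"
  assumes br: "bilinear br" "\<And>x. br x x = 0" and g: "bilinear g" "\<And>x y. g x y = g y x"
    and orth: "g v1 v2 = 0" "g v1 v3 = 0" "g v2 v3 = 0"
    and e: "g v1 v1 = \<epsilon>" "g v2 v2 = \<epsilon>" "g v3 v3 = - \<epsilon>" "\<bar>\<epsilon>\<bar> = 1"
    and brs: "br v1 v3 = 0" "br v2 v1 = a *\<^sub>R v1 + b *\<^sub>R v3" "br v2 v3 = - b *\<^sub>R v1 + d *\<^sub>R v3"
    and m: "a + d \<noteq> 0" and q: "a\<^sup>2 + d\<^sup>2 = 2 * b\<^sup>2"
  shows "\<exists>w1 w2 w3 t. soliton_frame br g w1 w2 w3 t \<epsilon>"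
proof -
  have b: "b \<noteq> 0" using q m by (auto simp: sum_power2_eq_zero_iff)
  define \<sigma> where "\<sigma> = sgn (a + d)"
  define \<rho> where "\<rho> = - sgn (\<sigma> * b)"
  have \<sigma>: "\<sigma> * \<sigma> = 1" using m by (simp add: \<sigma>_def sgn_mult_self_eq)
  then have \<sigma>0: "\<sigma> \<noteq> 0" by auto
  have \<rho>: "\<rho> * \<rho> = 1" using \<sigma>0 b by (simp add: \<rho>_def sgn_mult_self_eq)
  have pos: "\<sigma> * a + \<sigma> * d > 0"
    using m by (simp add: \<sigma>_def sgn_if algebra_simps)
  have neg: "\<rho> * (\<sigma> * b) < 0"
  proof -
    have "\<rho> * (\<sigma> * b) = - \<bar>\<sigma> * b\<bar>" by (simp add: \<rho>_def abs_sgn mult.commute)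
    then show ?thesis using \<sigma>0 b by simp
  qed
  have quad: "(\<sigma> * a)\<^sup>2 + (\<sigma> * d)\<^sup>2 = 2 * (\<rho> * (\<sigma> * b))\<^sup>2"
    using q \<sigma> \<rho> by (simp add: power_mult_distrib) (simp add: power2_eq_square)
  have R: "\<rho> * (\<rho> * x) = x" "\<sigma> * (\<sigma> * x) = x" "\<sigma> * (x * \<sigma>) = x" "\<rho> * (x * \<rho>) = x" for x :: real
    using \<sigma> \<rho> by (simp_all flip: mult.assoc add: mult.commute[of x])
  show ?thesis
  proof (rule boost_normal_form_aux[OF br g, of v1 "\<sigma> *\<^sub>R v2" "\<rho> *\<^sub>R v3" \<epsilon> "\<sigma> * a" "\<rho> * (\<sigma> * b)" "\<sigma> * d"])
    show "br (\<sigma> *\<^sub>R v2) v1 = (\<sigma> * a) *\<^sub>R v1 + (\<rho> * (\<sigma> * b)) *\<^sub>R \<rho> *\<^sub>R v3"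
      by (simp add: bilinear_lmul[OF br(1)] brs scaleR_right_distrib R mult.commute[of _ \<rho>])
    show "br (\<sigma> *\<^sub>R v2) (\<rho> *\<^sub>R v3) = - (\<rho> * (\<sigma> * b)) *\<^sub>R v1 + (\<sigma> * d) *\<^sub>R \<rho> *\<^sub>R v3"
      by (simp add: bilinear_lmul[OF br(1)] bilinear_rmul[OF br(1)] brs scaleR_right_distrib
          scaleR_diff_right mult_ac)
  qed (use orth e brs pos neg quad in
      \<open>simp_all add: bilinear_lmul[OF g(1)] bilinear_rmul[OF g(1)] bilinear_rmul[OF br(1)] R\<close>)
qed

theorem divergence_free_einstein_structure:
  fixes br :: "'a::euclidean_space \<Rightarrow> 'a \<Rightarrow> 'a"
  assumes L: "lie_algebra br" and dim: "DIM('a) = 3" and nonuni: "\<not> unimodular br"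
    and E: "generalized_einstein br H g (\<lambda>_. 0)"
  obtains v1 v2 v3 t \<epsilon> where "soliton_frame br g v1 v2 v3 t \<epsilon>" "\<And>x y z. H x y z = 0"
proof -
  note br = lie_algebra_bilinear[OF L] lie_algebra_alt[OF L]
  have H: "three_form H" and sp: "scalar_product g" and g: "bilinear g" "\<And>x y. g x y = g y x"
    using E by (auto simp: generalized_einstein_def scalar_product_def)
  obtain x0 where "trace_ad br x0 \<noteq> 0" using nonuni by (auto simp: unimodular_def)
  from adapted_frame_exists[OF sp dim linear_trace_ad[OF br(1)] this]
  show thesis
  proof (elim disjE exE conjE)
    fix v1 v2 v3
    assume e: "\<bar>g v1 v1\<bar> = 1" "\<bar>g v2 v2\<bar> = 1" "\<bar>g v3 v3\<bar> = 1"
      and orth: "g v1 v2 = 0" "g v1 v3 = 0" "g v2 v3 = 0"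
      and tr: "trace_ad br v1 = 0" "trace_ad br v2 \<noteq> 0" "trace_ad br v3 = 0"
    note d = orthonormal_dual_triples[OF g orth e]
    obtain a b c d' where brs: "br v1 v3 = 0" "br v2 v1 = a *\<^sub>R v1 + b *\<^sub>R v3"
      "br v2 v3 = c *\<^sub>R v1 + d' *\<^sub>R v3" and m: "a + d' \<noteq> 0"
      using nonunimodular_structure[OF L g(1) dim d tr] .
    note eqs = einstein_orthonormal[OF L dim E brs refl refl refl e orth]
    have "(H v1 v2 v3)\<^sup>2 = 0" using eqs(1,2) by linarith
    then have h: "H v1 v2 v3 = 0" by simp
    have H0: "H x y z = 0" for x y z
      by (rule three_form_eq_0[OF H dual_triples_basis(2)[OF g(1) dim d] h])
    have "b\<^sup>2 = c\<^sup>2" using eqs(1) h by simp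
    then have bc: "b = c \<or> b = - c" by (simp add: power2_eq_iff)
    have ad: "a\<^sup>2 + d'\<^sup>2 > 0"
    proof -
      have "a \<noteq> 0 \<or> d' \<noteq> 0" using m by auto
      then show ?thesis by (simp add: sum_power2_gt_zero_iff)
    qed
    have ee: "g v1 v1 * g v3 v3 = 1 \<or> g v1 v1 * g v3 v3 = - 1"
      using e by (auto simp: abs_if split: if_splits)
    have q: "2 * (a\<^sup>2 + d'\<^sup>2) + 2 * b * c + g v1 v1 * g v3 v3 * (b\<^sup>2 + c\<^sup>2) = 0"
      using eqs(3) h by simp
    \<comment> \<open>For equal signs \<open>q\<close> reads
      \<open>2 (a^2 + d'^2) + (b + c)^2 = 0\<close>, which excludes a definite kernel; for opposite
      signs it reads \<open>2 (a^2 + d'^2) = (b - c)^2\<close>, which excludes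
      \<open>b = c\<close>.\<close>
    have neg: "g v1 v1 * g v3 v3 = - 1"
    proof (rule ccontr)
      assume "\<not> ?thesis"
      then have "g v1 v1 * g v3 v3 = 1" using ee by blast
      then have "2 * (a\<^sup>2 + d'\<^sup>2) = - ((b + c)\<^sup>2)"
        using q by (simp add: power2_eq_square algebra_simps)
      also have "\<dots> \<le> 0" by simp
      finally show False using ad by simp
    qed
    moreover have "c = - b"
    proof (rule ccontr)
      assume "\<not> ?thesis"
      then have "b = c" using bc by auto
      then show False using q ad unfolding neg by (simp add: power2_eq_square)
    qed
    ultimately have "g v1 v1 * g v3 v3 = - 1 \<and> c = - b" by blast
    then have e13: "g v3 v3 = - g v1 v1" and c: "c = - b"
      using e by (auto simp: abs_if split: if_splits)
    have q2: "a\<^sup>2 + d'\<^sup>2 = 2 * b\<^sup>2"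
    proof -
      have "g v1 v1 * g v1 v1 = 1" using e by (auto simp: abs_if split: if_splits)
      then show ?thesis using q by (simp add: c e13 power2_eq_square algebra_simps)
    qed
    show thesis
    proof (cases "g v1 v1 = g v2 v2")
      case True
      have "\<exists>w1 w2 w3 t. soliton_frame br g w1 w2 w3 t (g v1 v1)"
        using brs c True[symmetric] e13 e m q2 by (intro boost_normal_form[OF br g orth]) auto
      then show thesis using that H0 by blast
    next
      case False
      \<comment> \<open>Now \<open>v3\<close> carries the sign of \<open>v2\<close>. Exchanging
        \<open>v1\<close> and \<open>v3\<close> exchanges \<open>a\<close> with \<open>d'\<close>
        and reverses \<open>b\<close>, so the same normal form applies.\<close>
      then have e2: "g v2 v2 = g v3 v3" using e e13 by (auto simp: abs_if split: if_splits)
      have "\<exists>w1 w2 w3 t. soliton_frame br g w1 w2 w3 t (g v3 v3)"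
      proof (rule boost_normal_form[OF br g])
        show "br v3 v1 = 0" using lie_algebra_skew[OF L, of v3 v1] brs by simp
        show "br v2 v3 = d' *\<^sub>R v3 + (- b) *\<^sub>R v1" "br v2 v1 = - (- b) *\<^sub>R v3 + a *\<^sub>R v1"
          using brs c by simp_all
      qed (use e e2 e13 m q2 g(2) orth in \<open>auto simp: add.commute\<close>)
      then show thesis using that H0 by blast
    qed
  next
    fix v1 v2 v3
    assume e: "g v1 v1 = 0" "g v1 v2 = 1" "g v2 v2 = 0" "g v1 v3 = 0" "g v2 v3 = 0" "\<bar>g v3 v3\<bar> = 1"
      and tr: "trace_ad br v1 = 0" "trace_ad br v2 \<noteq> 0" "trace_ad br v3 = 0"
    have "dual_triples g v1 v2 v3 v2 v1 (g v3 v3 *\<^sub>R v3)"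
      using e g(2)[of v1 v2] g(2)[of v1 v3] g(2)[of v2 v3]
      by (auto simp: dual_triples_def bilinear_rmul[OF g(1)] abs_if split: if_splits)
    from nonunimodular_structure[OF L g(1) dim this tr]
    obtain a b c d where brs: "br v1 v3 = 0" "br v2 v1 = a *\<^sub>R v1 + b *\<^sub>R v3"
      "br v2 v3 = c *\<^sub>R v1 + d *\<^sub>R v3" and m: "a + d \<noteq> 0" .
    from einstein_null_frame[OF L dim E brs e(1-5) refl e(6)] m show thesis by simp
  qed
qed

section \<open>The model Lie algebra\<close>

text \<open>The Levi-Civita connection restricted to left-invariant fields, as a product on the Lie
  algebra.\<close>

definition lc_product ::
    "('a::real_vector \<Rightarrow> 'a \<Rightarrow> 'a) \<Rightarrow> ('a \<Rightarrow> 'a \<Rightarrow> real) \<Rightarrow> ('a \<Rightarrow> 'a \<Rightarrow> 'a) \<Rightarrow> bool" where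
  "lc_product br g N \<longleftrightarrow> bilinear N \<and> (\<forall>x y z. 2 * g (N x y) z = koszul br g x y z)"

definition alg_curvature :: "('a \<Rightarrow> 'a \<Rightarrow> 'a) \<Rightarrow> ('a \<Rightarrow> 'a \<Rightarrow> 'a) \<Rightarrow> 'a \<Rightarrow> 'a \<Rightarrow> 'a \<Rightarrow> 'a::real_vector" where
  "alg_curvature br N x y z = N x (N y z) - N y (N x z) - N (br x y) z"

lemma koszul_linear:
  assumes "bilinear br" "bilinear g"
  shows "linear (koszul br g x y)" "linear (\<lambda>x. koszul br g x y z)" "linear (\<lambda>y. koszul br g x y z)"
  by (auto intro!: linearI simp: koszul_def bilinear_ladd[OF assms(1)] bilinear_radd[OF assms(1)]
      bilinear_lmul[OF assms(1)] bilinear_rmul[OF assms(1)] bilinear_ladd[OF assms(2)]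
      bilinear_radd[OF assms(2)] bilinear_lmul[OF assms(2)] bilinear_rmul[OF assms(2)] algebra_simps)

lemma lc_product_exists:
  fixes br :: "'a::euclidean_space \<Rightarrow> 'a \<Rightarrow> 'a"
  assumes br: "bilinear br" and dim: "DIM('a) = 3" and g: "scalar_product g"
    and d: "dual_triples g u v w u' v' w'"
  shows "\<exists>N. lc_product br g N"
proof -
  have bil: "bilinear g" and sym: "\<And>x y. g x y = g y x" using g by (auto simp: scalar_product_def)
  have d': "dual_triples g u' v' w' u v w" using d sym by (simp add: dual_triples_def)
  let ?N = "\<lambda>x y. (koszul br g x y u' / 2) *\<^sub>R u + (koszul br g x y v' / 2) *\<^sub>R v
      + (koszul br g x y w' / 2) *\<^sub>R w"
  note lin = koszul_linear[OF br bil]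
  have "bilinear ?N"
    unfolding bilinear_def
    by (auto intro!: linearI simp: linear_add[OF lin(2)] linear_scale[OF lin(2)]
        linear_add[OF lin(3)] linear_scale[OF lin(3)] add_divide_distrib scaleR_left_distrib
        scaleR_right_distrib)
  moreover have "2 * g (?N x y) z = koszul br g x y z" for x y z
  proof -
    have "koszul br g x y z = koszul br g x y (g z u *\<^sub>R u' + g z v *\<^sub>R v' + g z w *\<^sub>R w')"
      using dual_triples_basis(3)[OF bil dim d', of z] by simp
    then show ?thesis
      by (simp add: linear_add[OF lin(1)] linear_scale[OF lin(1)] bilinear_ladd[OF bil]
          bilinear_lmul[OF bil] sym[of z] algebra_simps)
  qed
  ultimately show ?thesis unfolding lc_product_def by blast
qed

locale soliton_algebra =
  fixes br :: "'a::euclidean_space \<Rightarrow> 'a \<Rightarrow> 'a" and g v1 v2 v3 t \<epsilon>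
  assumes dim: "DIM('a) = 3" and br: "bilinear br" and alt: "br x x = 0" and sp: "scalar_product g"
    and frame: "soliton_frame br g v1 v2 v3 t \<epsilon>"
begin

lemma bil: "bilinear g" and sym: "g x y = g y x"
  using sp by (auto simp: scalar_product_def)

lemma t_pos: "t > 0" and eps_square: "\<epsilon> * \<epsilon> = 1" and eps_cases: "\<epsilon> = 1 \<or> \<epsilon> = - 1"
  using frame by (auto simp: soliton_frame_def abs_if split: if_splits)

lemma g_table:
  "g v1 v1 = \<epsilon>" "g v2 v2 = \<epsilon>" "g v3 v3 = - \<epsilon>" "g v1 v2 = 0" "g v1 v3 = 0" "g v2 v3 = 0"
  "g v2 v1 = 0" "g v3 v1 = 0" "g v3 v2 = 0"
  using frame sym[of v1 v2] sym[of v1 v3] sym[of v2 v3] by (auto simp: soliton_frame_def)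

lemma br_table:
  "br v1 v3 = 0" "br v2 v1 = t *\<^sub>R v1 - t *\<^sub>R v3" "br v2 v3 = t *\<^sub>R v1 + t *\<^sub>R v3"
  "br v3 v1 = 0" "br v1 v2 = - t *\<^sub>R v1 + t *\<^sub>R v3" "br v3 v2 = - t *\<^sub>R v1 - t *\<^sub>R v3"
  using frame bilinear_alt_skew[OF br alt, of v3 v1] bilinear_alt_skew[OF br alt, of v1 v2]
    bilinear_alt_skew[OF br alt, of v3 v2] by (auto simp: soliton_frame_def)

lemma dual: "dual_triples g v1 v2 v3 (\<epsilon> *\<^sub>R v1) (\<epsilon> *\<^sub>R v2) ((- \<epsilon>) *\<^sub>R v3)"
  by (simp add: dual_triples_def bilinear_rmul[OF bil] bilinear_rneg[OF bil] g_table eps_square)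

lemma basis: "independent {v1, v2, v3}" "span {v1, v2, v3} = UNIV"
  by (rule dual_triples_basis[OF bil dim dual])+

lemma expand: "x = (\<epsilon> * g x v1) *\<^sub>R v1 + (\<epsilon> * g x v2) *\<^sub>R v2 + (- \<epsilon> * g x v3) *\<^sub>R v3"
  using dual_triples_basis(3)[OF bil dim dual, of x] by (simp add: bilinear_rmul[OF bil] bilinear_rneg[OF bil])

lemma trace: "linear f \<Longrightarrow> trace_on UNIV f = \<epsilon> * g (f v1) v1 + \<epsilon> * g (f v2) v2 - \<epsilon> * g (f v3) v3"
  using trace_dual_triples[OF bil dim dual, of f] by (simp add: bilinear_rmul[OF bil] bilinear_rneg[OF bil])

lemmas g_linear = bilinear_ladd[OF bil] bilinear_radd[OF bil] bilinear_lmul[OF bil] bilinear_rmul[OF bil]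
  bilinear_lsub[OF bil] bilinear_rsub[OF bil] bilinear_lneg[OF bil] bilinear_rneg[OF bil]
  bilinear_lzero[OF bil] bilinear_rzero[OF bil]

lemmas br_linear = bilinear_ladd[OF br] bilinear_radd[OF br] bilinear_lmul[OF br] bilinear_rmul[OF br]
  bilinear_lsub[OF br] bilinear_rsub[OF br] bilinear_lneg[OF br] bilinear_rneg[OF br]
  bilinear_lzero[OF br] bilinear_rzero[OF br]

lemma trace_ad_frame: "trace_ad br v1 = 0" "trace_ad br v2 = 2 * t" "trace_ad br v3 = 0"
proof -
  have "linear (br x)" for x using br by (simp add: bilinear_def)
  then show "trace_ad br v1 = 0" "trace_ad br v2 = 2 * t" "trace_ad br v3 = 0"
    by (simp_all add: trace_ad_def trace br_table alt g_linear g_table eps_square)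
qed

lemma kernel_iff: "x \<in> unimodular_kernel br \<longleftrightarrow> g x v2 = 0"
proof -
  note lin = linear_trace_ad[OF br]
  have "trace_ad br x = trace_ad br ((\<epsilon> * g x v1) *\<^sub>R v1 + (\<epsilon> * g x v2) *\<^sub>R v2 + (- \<epsilon> * g x v3) *\<^sub>R v3)"
    using expand[of x] by simp
  also have "\<dots> = \<epsilon> * g x v2 * (2 * t)"
    by (simp only: linear_add[OF lin] linear_scale[OF lin] trace_ad_frame) simp
  finally show ?thesis using t_pos eps_cases by (auto simp: unimodular_kernel_def)
qed

lemma indefinite: "indefinite_on (unimodular_kernel br) g"
  unfolding indefinite_on_def using eps_cases
  by (auto simp: kernel_iff g_table intro: bexI[of _ v1] bexI[of _ v3])

lemma nondegenerate: "nondegenerate_on (unimodular_kernel br) g"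
  unfolding nondegenerate_on_def
proof (intro ballI impI)
  fix x assume "x \<in> unimodular_kernel br" and "\<forall>y\<in>unimodular_kernel br. g x y = 0"
  then have "g x v1 = 0" "g x v2 = 0" "g x v3 = 0" by (auto simp: kernel_iff g_table)
  then show "x = 0" using expand[of x] by simp
qed

lemma isomorphic:
  "lie_isomorphic br (semidirect_bracket (vector [vector [1, 1], vector [-1, 1]] :: real^2^2))"
proof -
  \<comment> \<open>The first coordinate is scaled by \<open>t\<close>: the generator acting by the
    matrix is \<open>v2\<close> divided by \<open>t\<close>, so the constant disappears from the
    isomorphism type.\<close>
  define f :: "'a \<Rightarrow> real \<times> (real^2)" where
    "f x = (t * (\<epsilon> * g x v2), vector [\<epsilon> * g x v1, - \<epsilon> * g x v3])" for x
  have "linear f"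
    by (auto intro!: linearI simp: f_def g_linear vec_eq_iff forall_2 algebra_simps)
  moreover have "bij f"
  proof (rule bijI)
    show "inj f"
    proof (rule injI)
      fix x y assume "f x = f y"
      then have "g x v1 = g y v1" "g x v2 = g y v2" "g x v3 = g y v3"
        using t_pos eps_cases by (auto simp: f_def vec_eq_iff forall_2)
      then show "x = y" using expand[of x] expand[of y] by simp
    qed
    have "f ((w $ 1) *\<^sub>R v1 + (r / t) *\<^sub>R v2 + (w $ 2) *\<^sub>R v3) = (r, w)" for r w
      using t_pos eps_square by (simp add: f_def g_linear g_table vec_eq_iff forall_2)
    then show "surj f" by (metis surj_def surj_pair)
  qed
  moreover have "f (br x y) = semidirect_bracket (vector [vector [1, 1], vector [-1, 1]]) (f x) (f y)" for x y
  proof -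
    obtain x1 x2 x3 y1 y2 y3 where x: "x = x1 *\<^sub>R v1 + x2 *\<^sub>R v2 + x3 *\<^sub>R v3"
      and y: "y = y1 *\<^sub>R v1 + y2 *\<^sub>R v2 + y3 *\<^sub>R v3"
      using expand[of x] expand[of y] by metis
    have f: "f (a *\<^sub>R v1 + b *\<^sub>R v2 + c *\<^sub>R v3) = (t * b, vector [a, c])" for a b c
      using eps_cases by (auto simp: f_def g_linear g_table)
    have "br x y = (t * (x2 * y1 - x1 * y2 + x2 * y3 - x3 * y2)) *\<^sub>R v1 + 0 *\<^sub>R v2
        + (t * (x1 * y2 - x2 * y1 + x2 * y3 - x3 * y2)) *\<^sub>R v3"
      by (simp add: x y br_linear br_table alt algebra_simps)
    then have "f (br x y) = (t * 0, vector [t * (x2 * y1 - x1 * y2 + x2 * y3 - x3 * y2),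
        t * (x1 * y2 - x2 * y1 + x2 * y3 - x3 * y2)])"
      by (simp only: f)
    moreover have "f x = (t * x2, vector [x1, x3])" "f y = (t * y2, vector [y1, y3])"
      unfolding x y by (rule f)+
    ultimately show ?thesis
      by (simp add: semidirect_bracket_def matrix_vector_mult_def vec_eq_iff forall_2 sum_2 algebra_simps)
  qed
  ultimately show ?thesis unfolding lie_isomorphic_def by blast
qed

context
  fixes N assumes N: "lc_product br g N"
begin

lemma bilinear_N: "bilinear N" and N_koszul: "2 * g (N x y) z = koszul br g x y z"
  using N by (auto simp: lc_product_def)

lemma N_table:
  "N v1 v1 = t *\<^sub>R v2" "N v1 v2 = - t *\<^sub>R v1 + t *\<^sub>R v3" "N v1 v3 = t *\<^sub>R v2"
  "N v2 v1 = 0" "N v2 v2 = 0" "N v2 v3 = 0"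
  "N v3 v1 = t *\<^sub>R v2" "N v3 v2 = - t *\<^sub>R v1 - t *\<^sub>R v3" "N v3 v3 = - t *\<^sub>R v2"
proof -
  have eq: "N x y = z"
    if "koszul br g x y v1 = 2 * g z v1" "koszul br g x y v2 = 2 * g z v2" "koszul br g x y v3 = 2 * g z v3"
    for x y z
    using that expand[of "N x y"] expand[of z] by (simp flip: N_koszul)
  show "N v1 v1 = t *\<^sub>R v2" "N v1 v2 = - t *\<^sub>R v1 + t *\<^sub>R v3" "N v1 v3 = t *\<^sub>R v2"
    "N v2 v1 = 0" "N v2 v2 = 0" "N v2 v3 = 0"
    "N v3 v1 = t *\<^sub>R v2" "N v3 v2 = - t *\<^sub>R v1 - t *\<^sub>R v3" "N v3 v3 = - t *\<^sub>R v2"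
    by (rule eq; simp add: koszul_def br_table alt g_linear g_table)+
qed

lemmas N_linear = bilinear_ladd[OF bilinear_N] bilinear_radd[OF bilinear_N] bilinear_lmul[OF bilinear_N]
  bilinear_rmul[OF bilinear_N] bilinear_lsub[OF bilinear_N] bilinear_rsub[OF bilinear_N]
  bilinear_lneg[OF bilinear_N] bilinear_rneg[OF bilinear_N] bilinear_lzero[OF bilinear_N]
  bilinear_rzero[OF bilinear_N]

lemma linear_alg_curvature:
  "linear (\<lambda>x. alg_curvature br N x y z)" "linear (\<lambda>y. alg_curvature br N x y z)"
  "linear (alg_curvature br N x y)"
  by (auto intro!: linearI simp: alg_curvature_def N_linear br_linear algebra_simps)

text \<open>On the kernel, \<open>S = ad v2\<close> is g-selfadjoint with trace
  \<open>2 * t\<close>, and the Ricci form there is \<open>- \<epsilon> tr(S) g(S _, _)\<close>; on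
  \<open>v2\<close> it is \<open>- tr(S^2) = 0\<close>. This is the origin of the factor
  \<open>- 2 * t * \<epsilon>\<close>. The right-hand side is minus half the Lie derivative of
  \<open>g\<close> along the left-invariant field.\<close>

lemma soliton_equation:
  "trace_on UNIV (\<lambda>x. alg_curvature br N x y z) =
     (g (br ((- 2 * t * \<epsilon>) *\<^sub>R v2) y) z + g y (br ((- 2 * t * \<epsilon>) *\<^sub>R v2) z)) / 2"
proof -
  define F where "F y z = trace_on UNIV (\<lambda>x. alg_curvature br N x y z)" for y z
  define G where "G y z = (g (br ((- 2 * t * \<epsilon>) *\<^sub>R v2) y) z + g y (br ((- 2 * t * \<epsilon>) *\<^sub>R v2) z)) / 2" for y z
  have F: "F y z = \<epsilon> * g (alg_curvature br N v1 y z) v1 + \<epsilon> * g (alg_curvature br N v2 y z) v2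
      - \<epsilon> * g (alg_curvature br N v3 y z) v3" for y z
    unfolding F_def by (rule trace[OF linear_alg_curvature(1)])
  have "bilinear F"
    unfolding bilinear_def F
    by (auto intro!: linearI simp: linear_add[OF linear_alg_curvature(2)] linear_scale[OF linear_alg_curvature(2)]
        linear_add[OF linear_alg_curvature(3)] linear_scale[OF linear_alg_curvature(3)] g_linear algebra_simps)
  moreover have "bilinear G"
    unfolding bilinear_def G_def
    by (auto intro!: linearI simp: g_linear br_linear field_simps)
  moreover have "F y z = G y z" if "y \<in> {v1, v2, v3}" "z \<in> {v1, v2, v3}" for y z
    using that
    by (auto simp: F G_def alg_curvature_def N_linear N_table br_linear br_table alt g_linear g_table
        algebra_simps)
  ultimately have "F y z = G y z"
    using bilinear_eq[of F G UNIV "{v1, v2, v3}" UNIV "{v1, v2, v3}"] basis by blast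
  then show ?thesis by (simp add: F_def G_def)
qed

lemma sectional_curvatures:
  "g (alg_curvature br N v1 v2 v2) v1 = 0" "g (alg_curvature br N v1 v3 v3) v1 = 2 * t * t * \<epsilon>"
  by (auto simp: alg_curvature_def N_linear N_table br_linear br_table alt g_linear g_table algebra_simps)

end

end

section \<open>Curvature in a moving frame\<close>

lemma second_difference_estimate:
  fixes f :: "'a::real_normed_vector \<Rightarrow> real"
  assumes U: "open U" "x \<in> U" and f: "\<And>y. y \<in> U \<Longrightarrow> (f has_derivative f' y) (at y)"
    and A: "((\<lambda>y. f' y u) has_derivative A) (at x)" and e: "e > 0"
  shows "\<exists>d>0. \<forall>s. 0 < s \<and> s < d \<longrightarrow>
     \<bar>f (x + s *\<^sub>R u + s *\<^sub>R v) - f (x + s *\<^sub>R u) - f (x + s *\<^sub>R v) + f x - s * s * A v\<bar>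
       \<le> 2 * e * s * s * (norm u + norm v)"
proof -
  have linA: "linear A" using A by (simp add: has_derivative_linear)
  obtain d1 where d1: "d1 > 0"
    "\<And>y. norm (y - x) < d1 \<Longrightarrow> norm (f' y u - f' x u - A (y - x)) \<le> e * norm (y - x)"
    using A e unfolding has_derivative_at_alt by blast
  obtain d2 where d2: "d2 > 0" "ball x d2 \<subseteq> U" using U open_contains_ball by blast
  define K where "K = norm u + norm v + 1"
  have K: "K > 0" by (simp add: K_def add_nonneg_pos)
  define d where "d = min d1 d2 / K"
  have near: "norm (r *\<^sub>R u + q *\<^sub>R v) < min d1 d2" "norm (r *\<^sub>R u + q *\<^sub>R v) \<le> s * (norm u + norm v)"
    if "0 \<le> r" "r \<le> s" "0 \<le> q" "q \<le> s" "s < d" "0 < s" for r q s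
  proof -
    have "norm (r *\<^sub>R u + q *\<^sub>R v) \<le> r * norm u + q * norm v"
      using norm_triangle_ineq[of "r *\<^sub>R u" "q *\<^sub>R v"] that by simp
    also have "\<dots> \<le> s * norm u + s * norm v"
      using that by (intro add_mono mult_right_mono) auto
    finally show 1: "norm (r *\<^sub>R u + q *\<^sub>R v) \<le> s * (norm u + norm v)" by (simp add: algebra_simps)
    also have "\<dots> < s * K" using that by (simp add: K_def)
    also have "s * K < min d1 d2" using that K by (simp add: d_def pos_less_divide_eq)
    finally show "norm (r *\<^sub>R u + q *\<^sub>R v) < min d1 d2" .
  qed
  show ?thesis
  proof (intro exI[of _ d] conjI allI impI)
    show "d > 0" using d1 d2 K by (simp add: d_def)
    fix s :: real assume s: "0 < s \<and> s < d"
    \<comment> \<open>The mean value theorem in the direction \<open>u\<close> is applied to the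
      increment in the direction \<open>v\<close>; its derivative is then compared with the linear
      approximation of \<open>f' _ u\<close> at the single point \<open>x\<close>.\<close>
    define \<phi> where "\<phi> r = f (x + r *\<^sub>R u + s *\<^sub>R v) - f (x + r *\<^sub>R u)" for r
    define \<phi>' where "\<phi>' r = f' (x + r *\<^sub>R u + s *\<^sub>R v) u - f' (x + r *\<^sub>R u) u" for r
    have "DERIV \<phi> r :> \<phi>' r" if r: "0 \<le> r" "r \<le> s" for r
    proof -
      have inU: "x + r *\<^sub>R u + s *\<^sub>R v \<in> U" "x + r *\<^sub>R u \<in> U"
        using near(1)[of r s s] near(1)[of r s 0] r s d2
        by (auto simp: dist_norm subset_iff norm_minus_commute add.assoc)
      have lin: "linear (f' y)" if "y \<in> U" for y
        using f[OF that] by (simp add: has_derivative_linear)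
      have "(\<phi> has_derivative (\<lambda>h. f' (x + r *\<^sub>R u + s *\<^sub>R v) (h *\<^sub>R u) - f' (x + r *\<^sub>R u) (h *\<^sub>R u))) (at r)"
        unfolding \<phi>_def
      proof (rule has_derivative_diff)
        show "((\<lambda>r. f (x + r *\<^sub>R u + s *\<^sub>R v)) has_derivative
            (\<lambda>h. f' (x + r *\<^sub>R u + s *\<^sub>R v) (h *\<^sub>R u))) (at r)"
          by (rule has_derivative_compose[where g = f and f = "\<lambda>r. x + r *\<^sub>R u + s *\<^sub>R v", OF _ f[OF inU(1)]])
            (auto intro!: derivative_eq_intros)
        show "((\<lambda>r. f (x + r *\<^sub>R u)) has_derivative (\<lambda>h. f' (x + r *\<^sub>R u) (h *\<^sub>R u))) (at r)"
          by (rule has_derivative_compose[where g = f and f = "\<lambda>r. x + r *\<^sub>R u", OF _ f[OF inU(2)]])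
            (auto intro!: derivative_eq_intros)
      qed
      then show ?thesis
        by (simp add: has_field_derivative_def linear_scale[OF lin] inU \<phi>'_def
            flip: right_diff_distrib) (simp add: mult_commute_abs)
    qed
    then obtain r where r: "0 < r" "r < s" "\<phi> s - \<phi> 0 = (s - 0) * \<phi>' r"
      using MVT2[of 0 s \<phi> \<phi>'] s by auto
    have "\<bar>f' (x + (r *\<^sub>R u + s *\<^sub>R v)) u - f' x u - A (r *\<^sub>R u + s *\<^sub>R v)\<bar> \<le> e * (s * (norm u + norm v))"
      using d1(2)[of "x + (r *\<^sub>R u + s *\<^sub>R v)"] near[of r s s] r s e
      by (smt (verit, ccfv_threshold) add_diff_cancel_left' mult_left_mono real_norm_def)
    moreover have "\<bar>f' (x + r *\<^sub>R u) u - f' x u - A (r *\<^sub>R u)\<bar> \<le> e * (s * (norm u + norm v))"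
      using d1(2)[of "x + r *\<^sub>R u"] near[of r s 0] r s e
      by (smt (verit, ccfv_threshold) add_diff_cancel_left' mult_left_mono real_norm_def
          scale_zero_left add.right_neutral)
    moreover have "A (r *\<^sub>R u + s *\<^sub>R v) = A (r *\<^sub>R u) + s * A v"
      by (simp add: linear_add[OF linA] linear_scale[OF linA])
    ultimately have "\<bar>\<phi>' r - s * A v\<bar> \<le> 2 * (e * (s * (norm u + norm v)))"
      unfolding \<phi>'_def add.assoc by linarith
    then have "s * \<bar>\<phi>' r - s * A v\<bar> \<le> s * (2 * (e * (s * (norm u + norm v))))"
      using s by (intro mult_left_mono) auto
    moreover have "s * \<bar>\<phi>' r - s * A v\<bar> = \<bar>s * \<phi>' r - s * s * A v\<bar>"
    proof -
      have "\<bar>s * (\<phi>' r - s * A v)\<bar> = s * \<bar>\<phi>' r - s * A v\<bar>" using s by (simp add: abs_mult)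
      then show ?thesis by (simp add: algebra_simps)
    qed
    moreover have "s * \<phi>' r = f (x + s *\<^sub>R u + s *\<^sub>R v) - f (x + s *\<^sub>R u) - f (x + s *\<^sub>R v) + f x"
      using r(3) by (simp add: \<phi>_def)
    ultimately show "\<bar>f (x + s *\<^sub>R u + s *\<^sub>R v) - f (x + s *\<^sub>R u) - f (x + s *\<^sub>R v) + f x - s * s * A v\<bar>
       \<le> 2 * e * s * s * (norm u + norm v)"
      by (simp add: algebra_simps)
  qed
qed

text \<open>The second difference is symmetric in \<open>u\<close> and \<open>v\<close>; divided by
  \<open>s * s\<close>, it tends to both \<open>A v\<close> and \<open>B u\<close>.\<close>

lemma second_derivative_symmetric_real:
  fixes f :: "'a::real_normed_vector \<Rightarrow> real"
  assumes U: "open U" "x \<in> U" and f: "\<And>y. y \<in> U \<Longrightarrow> (f has_derivative f' y) (at y)"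
    and A: "((\<lambda>y. f' y u) has_derivative A) (at x)" and B: "((\<lambda>y. f' y v) has_derivative B) (at x)"
  shows "A v = B u"
proof (rule ccontr)
  assume "A v \<noteq> B u"
  define k where "k = norm u + norm v + 1"
  have k: "k > 0" by (simp add: k_def add_nonneg_pos)
  \<comment> \<open>The two errors add up to at most \<open>4 * e * k\<close> after division by
    \<open>s * s\<close>, so the 5 makes them smaller than the supposed gap. The summand 1 in
    \<open>k\<close> covers \<open>u = v = 0\<close>.\<close>
  define e where "e = \<bar>A v - B u\<bar> / (5 * k)"
  have e: "e > 0" using \<open>A v \<noteq> B u\<close> k by (simp add: e_def)
  obtain d1 where d1: "d1 > 0" "\<And>s. 0 < s \<Longrightarrow> s < d1 \<Longrightarrow>
     \<bar>f (x + s *\<^sub>R u + s *\<^sub>R v) - f (x + s *\<^sub>R u) - f (x + s *\<^sub>R v) + f x - s * s * A v\<bar>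
       \<le> 2 * e * s * s * (norm u + norm v)"
    using second_difference_estimate[OF U f A e, of v] by blast
  obtain d2 where d2: "d2 > 0" "\<And>s. 0 < s \<Longrightarrow> s < d2 \<Longrightarrow>
     \<bar>f (x + s *\<^sub>R v + s *\<^sub>R u) - f (x + s *\<^sub>R v) - f (x + s *\<^sub>R u) + f x - s * s * B u\<bar>
       \<le> 2 * e * s * s * (norm v + norm u)"
    using second_difference_estimate[OF U f B e, of u] by blast
  define s where "s = min d1 d2 / 2"
  have s: "0 < s" "s < d1" "s < d2" using d1 d2 by (auto simp: s_def)
  have swap: "x + s *\<^sub>R v + s *\<^sub>R u = x + s *\<^sub>R u + s *\<^sub>R v" by simp
  have "\<bar>s * s * A v - s * s * B u\<bar> \<le> 2 * (2 * e * s * s * (norm u + norm v))"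
    using d1(2)[OF s(1,2)] d2(2)[OF s(1,3)] unfolding swap add.commute[of "norm v"] by linarith
  moreover have "\<bar>s * s * A v - s * s * B u\<bar> = s * s * \<bar>A v - B u\<bar>"
    using s by (simp add: abs_mult flip: right_diff_distrib)
  ultimately have "s * s * \<bar>A v - B u\<bar> \<le> s * s * (4 * e * (norm u + norm v))"
    by (simp add: algebra_simps)
  then have "\<bar>A v - B u\<bar> \<le> 4 * e * (norm u + norm v)" using s by simp
  also have "\<dots> \<le> 4 * e * k" using e by (simp add: k_def)
  also have "\<dots> < 5 * e * k" using e k by simp
  finally show False using k by (simp add: e_def)
qed

lemma second_derivative_symmetric:
  fixes f :: "'a::real_normed_vector \<Rightarrow> 'b::euclidean_space"
  assumes U: "open U" "x \<in> U" and f: "\<And>y. y \<in> U \<Longrightarrow> (f has_derivative f' y) (at y)"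
    and A: "((\<lambda>y. f' y u) has_derivative A) (at x)" and B: "((\<lambda>y. f' y v) has_derivative B) (at x)"
  shows "A v = B u"
proof (rule euclidean_eqI)
  fix b :: 'b assume "b \<in> Basis"
  show "A v \<bullet> b = B u \<bullet> b"
    by (rule second_derivative_symmetric_real[OF U, of "\<lambda>y. f y \<bullet> b" "\<lambda>y h. f' y h \<bullet> b"])
      (auto intro!: has_derivative_inner_left f A B)
qed

text \<open>\<open>F x\<close> is, in coordinates, the left-invariant field with value \<open>x\<close> in the Lie algebra.\<close>

locale moving_frame =
  fixes U :: "'a::euclidean_space set" and F :: "'a \<Rightarrow> 'a \<Rightarrow> 'a"
    and br :: "'a \<Rightarrow> 'a \<Rightarrow> 'a" and g :: "'a \<Rightarrow> 'a \<Rightarrow> real"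
  assumes openU: "open U"
    and linear_F: "q \<in> U \<Longrightarrow> linear (\<lambda>x. F x q)"
    and inj_F: "q \<in> U \<Longrightarrow> inj (\<lambda>x. F x q)"
    and differentiable_F: "q \<in> U \<Longrightarrow> F x differentiable (at q)"
    and differentiable_dF: "q \<in> U \<Longrightarrow> (\<lambda>q. frechet_derivative (F x) (at q) u) differentiable (at q)"
    and bracket_F: "q \<in> U \<Longrightarrow> F (br x y) q = field_bracket (F x) (F y) q"
    and br: "bilinear br" and alt: "br x x = 0" and sp: "scalar_product g"
begin

text \<open>The Maurer-Cartan form in coordinates: the Lie algebra element of a tangent
  vector.\<close>

definition \<theta> :: "'a \<Rightarrow> 'a \<Rightarrow> 'a" where
  "\<theta> q = inv_into UNIV (\<lambda>x. F x q)"

definition dF :: "'a \<Rightarrow> 'a \<Rightarrow> 'a \<Rightarrow> 'a" where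
  "dF x q = frechet_derivative (F x) (at q)"

lemma \<theta>_F [simp]: "q \<in> U \<Longrightarrow> \<theta> q (F x q) = x"
  unfolding \<theta>_def by (rule inv_f_f[OF inj_F])

lemma F_\<theta> [simp]: "q \<in> U \<Longrightarrow> F (\<theta> q u) q = u"
  unfolding \<theta>_def
  by (rule surj_f_inv_f[where f = "\<lambda>x. F x q",
        OF linear_injective_imp_surjective[OF linear_F[of q] inj_F[of q]]]) simp_all

lemma linear_\<theta>:
  assumes q: "q \<in> U" shows "linear (\<theta> q)"
proof (rule linearI)
  fix u w and r :: real
  have "\<theta> q (u + w) = \<theta> q (F (\<theta> q u + \<theta> q w) q)"
    using q by (simp add: linear_add[OF linear_F] del: \<theta>_F)
  then show "\<theta> q (u + w) = \<theta> q u + \<theta> q w" using q by simp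
  have "\<theta> q (r *\<^sub>R u) = \<theta> q (F (r *\<^sub>R \<theta> q u) q)"
    using q by (simp add: linear_scale[OF linear_F] del: \<theta>_F)
  then show "\<theta> q (r *\<^sub>R u) = r *\<^sub>R \<theta> q u" using q by simp
qed

lemma dF: "q \<in> U \<Longrightarrow> (F x has_derivative dF x q) (at q)"
  unfolding dF_def using differentiable_F frechet_derivative_works by blast

lemma linear_dF: "q \<in> U \<Longrightarrow> linear (dF x q)" "q \<in> U \<Longrightarrow> linear (\<lambda>x. dF x q h)"
proof -
  assume q: "q \<in> U"
  show "linear (dF x q)" by (rule has_derivative_linear[OF dF[OF q]])
  show "linear (\<lambda>x. dF x q h)"
  proof (rule linearI)
    fix x y and r :: real
    have "(F (x + y) has_derivative (\<lambda>h. dF x q h + dF y q h)) (at q)"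
      by (rule has_derivative_transform_within_open[OF has_derivative_add[OF dF[OF q] dF[OF q]] openU q])
        (simp add: linear_add[OF linear_F])
    from has_derivative_unique[OF dF[OF q] this] show "dF (x + y) q h = dF x q h + dF y q h" by simp
    have "(F (r *\<^sub>R x) has_derivative (\<lambda>h. r *\<^sub>R dF x q h)) (at q)"
      by (rule has_derivative_transform_within_open[OF has_derivative_scaleR_right[OF dF[OF q]] openU q])
        (simp add: linear_scale[OF linear_F])
    from has_derivative_unique[OF dF[OF q] this] show "dF (r *\<^sub>R x) q h = r *\<^sub>R dF x q h" by simp
  qed
qed

lemma sum_Basis_linear: "linear f \<Longrightarrow> (\<Sum>b\<in>Basis. (x \<bullet> b) *\<^sub>R f b) = f x"
  for f :: "'a \<Rightarrow> 'a"
proof -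
  assume f: "linear f"
  have "f x = f (\<Sum>b\<in>Basis. (x \<bullet> b) *\<^sub>R b)" by (simp add: euclidean_representation)
  also have "\<dots> = (\<Sum>b\<in>Basis. (x \<bullet> b) *\<^sub>R f b)" by (simp add: linear_sum[OF f] linear_scale[OF f])
  finally show ?thesis ..
qed

text \<open>Product rule when the frame argument varies with the point: linearity turns
  \<open>F (y z)\<close> into a finite sum of fixed fields \<open>F b\<close> with differentiable
  coefficients. The parameter space is general because the inverse function argument below
  differentiates on pairs.\<close>

lemma has_derivative_F:
  fixes y :: "'b::real_normed_vector \<Rightarrow> 'a"
  assumes p: "(p has_derivative p') (at z)" and y: "(y has_derivative y') (at z)" and z: "p z \<in> U"
    and V: "open V" "z \<in> V" "\<And>z. z \<in> V \<Longrightarrow> p z \<in> U"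
  shows "((\<lambda>z. F (y z) (p z)) has_derivative (\<lambda>h. F (y' h) (p z) + dF (y z) (p z) (p' h))) (at z)"
proof -
  have "((\<lambda>z. \<Sum>b\<in>Basis. (y z \<bullet> b) *\<^sub>R F b (p z)) has_derivative
      (\<lambda>h. \<Sum>b\<in>Basis. (y z \<bullet> b) *\<^sub>R dF b (p z) (p' h) + (y' h \<bullet> b) *\<^sub>R F b (p z))) (at z)"
    by (intro has_derivative_sum has_derivative_scaleR has_derivative_inner_left y
        has_derivative_compose[OF p dF[OF z]])
  then have "((\<lambda>z. \<Sum>b\<in>Basis. (y z \<bullet> b) *\<^sub>R F b (p z)) has_derivative
      (\<lambda>h. F (y' h) (p z) + dF (y z) (p z) (p' h))) (at z)"
    by (simp add: sum.distrib sum_Basis_linear[OF linear_F[OF z]] sum_Basis_linear[OF linear_dF(2)[OF z]]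
        add.commute)
  then show ?thesis
    by (rule has_derivative_transform_within_open[OF _ V(1,2)])
      (simp add: sum_Basis_linear[OF linear_F[OF V(3)]])
qed

text \<open>The map \<open>(q, u) \<mapsto> (q, \<theta> q u)\<close> inverts \<open>(q, x) \<mapsto> (q, F x q)\<close>, so the inverse function theorem
  applies to it.\<close>

lemma has_derivative_\<theta>_pair:
  assumes q: "q \<in> U"
  shows "((\<lambda>z. (fst z, \<theta> (fst z) (snd z))) has_derivative
     (\<lambda>h. (fst h, \<theta> q (snd h - dF (\<theta> q u) q (fst h))))) (at (q, u))"
proof -
  let ?\<Phi> = "\<lambda>z. (fst z, F (snd z) (fst z))"
  let ?V = "U \<times> (UNIV :: 'a set)"
  have V: "open ?V" using openU by (simp add: open_Times)
  have \<Phi>: "(?\<Phi> has_derivative (\<lambda>h. (fst h, F (snd h) (fst z) + dF (snd z) (fst z) (fst h)))) (at z)"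
    if "z \<in> ?V" for z
    using that V
    by (intro has_derivative_Pair has_derivative_F[where V = ?V] has_derivative_fst has_derivative_snd
        has_derivative_ident) auto
  have "((\<lambda>z. (fst z, \<theta> (fst z) (snd z))) has_derivative
     (\<lambda>h. (fst h, \<theta> q (snd h - dF (\<theta> q u) q (fst h))))) (at (?\<Phi> (q, \<theta> q u)))"
  proof (rule has_derivative_inverse_strong[where f = ?\<Phi> and x = "(q, \<theta> q u)" and S = ?V, OF V])
    show "continuous_on ?V ?\<Phi>"
      by (rule has_derivative_continuous_on) (rule has_derivative_at_withinI[OF \<Phi>])
    show "(?\<Phi> has_derivative (\<lambda>h. (fst h, F (snd h) q + dF (\<theta> q u) q (fst h)))) (at (q, \<theta> q u))"
      using \<Phi>[of "(q, \<theta> q u)"] q by simp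
  qed (use q in \<open>auto simp: fun_eq_iff\<close>)
  then show ?thesis using q by simp
qed

lemma has_derivative_\<theta>:
  assumes q: "q \<in> U" and Y: "(Y has_derivative Y') (at q)"
  shows "((\<lambda>q. \<theta> q (Y q)) has_derivative (\<lambda>h. \<theta> q (Y' h - dF (\<theta> q (Y q)) q h))) (at q)"
proof -
  have "((\<lambda>q. (q, Y q)) has_derivative (\<lambda>h. (h, Y' h))) (at q)"
    by (intro has_derivative_Pair has_derivative_ident Y)
  from has_derivative_snd[OF has_derivative_compose[OF this has_derivative_\<theta>_pair[OF q]]]
  show ?thesis by simp
qed

text \<open>The derivative of an inverse matrix, \<open>- F^-1 (dF) F^-1\<close>, applied to
  \<open>w\<close>.\<close>

definition d\<theta> :: "'a \<Rightarrow> 'a \<Rightarrow> 'a \<Rightarrow> 'a" where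
  "d\<theta> w q h = - \<theta> q (dF (\<theta> q w) q h)"

lemma d\<theta>: "q \<in> U \<Longrightarrow> ((\<lambda>q. \<theta> q w) has_derivative d\<theta> w q) (at q)"
  unfolding d\<theta>_def[abs_def]
  using has_derivative_\<theta>[of q "\<lambda>_. w" "\<lambda>_. 0"] by (simp add: linear_neg[OF linear_\<theta>])

text \<open>The Maurer-Cartan equation. It is \<open>bracket_F\<close> for the two frame fields that
  take the values \<open>u\<close> and \<open>w\<close> at \<open>q\<close>.\<close>

lemma d\<theta>_skew: "q \<in> U \<Longrightarrow> d\<theta> w q u - d\<theta> u q w = - br (\<theta> q u) (\<theta> q w)"
proof -
  assume q: "q \<in> U"
  have "\<theta> q (F (br (\<theta> q u) (\<theta> q w)) q) = \<theta> q (dF (\<theta> q w) q u - dF (\<theta> q u) q w)"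
    unfolding bracket_F[OF q] by (simp add: field_bracket_def dF_def q)
  then show ?thesis by (simp add: q d\<theta>_def linear_diff[OF linear_\<theta>])
qed

lemma linear_d\<theta>: "q \<in> U \<Longrightarrow> linear (d\<theta> w q)"
  by (rule has_derivative_linear[OF d\<theta>])

definition dd\<theta> :: "'a \<Rightarrow> 'a \<Rightarrow> 'a \<Rightarrow> 'a \<Rightarrow> 'a" where
  "dd\<theta> w v q = frechet_derivative (\<lambda>q. d\<theta> w q v) (at q)"

lemma dd\<theta>: assumes q: "q \<in> U" shows "((\<lambda>q. d\<theta> w q v) has_derivative dd\<theta> w v q) (at q)"
proof -
  \<comment> \<open>Differentiability of \<open>dF\<close> is known only for a fixed field, hence
    the expansion of the moving argument in the basis.\<close>
  have "(\<lambda>q. \<Sum>b\<in>Basis. (\<theta> q w \<bullet> b) *\<^sub>R dF b q v) differentiable (at q)"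
    unfolding dF_def
    by (intro differentiable_sum differentiable_scaleR differentiable_inner differentiable_dF q ballI
        differentiable_const) (use d\<theta>[OF q] in \<open>auto simp: differentiable_def\<close>)
  then obtain Y' where "((\<lambda>q. \<Sum>b\<in>Basis. (\<theta> q w \<bullet> b) *\<^sub>R dF b q v) has_derivative Y') (at q)"
    by (auto simp: differentiable_def)
  then have "((\<lambda>q. dF (\<theta> q w) q v) has_derivative Y') (at q)"
    by (rule has_derivative_transform_within_open[OF _ openU q])
      (simp add: sum_Basis_linear[OF linear_dF(2)])
  from has_derivative_minus[OF has_derivative_\<theta>[OF q this]]
  have "(\<lambda>q. d\<theta> w q v) differentiable (at q)"
    unfolding d\<theta>_def by (auto simp: differentiable_def)
  then show ?thesis unfolding dd\<theta>_def using frechet_derivative_works by blast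
qed

text \<open>This removes the second derivatives of the coframe from the curvature.\<close>

lemma dd\<theta>_symmetric: "q \<in> U \<Longrightarrow> dd\<theta> w v q u = dd\<theta> w u q v"
  by (rule second_derivative_symmetric[where f = "\<lambda>q. \<theta> q w" and f' = "d\<theta> w", OF openU _ d\<theta> dd\<theta> dd\<theta>])

end

section \<open>The metric, its connection and its curvature in the moving frame\<close>

context moving_frame
begin

definition \<gamma> :: "'a \<Rightarrow> 'a \<Rightarrow> 'a \<Rightarrow> real" where
  "\<gamma> q u v = g (\<theta> q u) (\<theta> q v)"

lemma bilinear_g: "bilinear g" and g_sym: "g x y = g y x"
  and g_nondegenerate: "(\<And>y. g x y = g z y) \<Longrightarrow> x = z"
proof -
  show bil: "bilinear g" and "g x y = g y x" using sp by (auto simp: scalar_product_def)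
  assume "\<And>y. g x y = g z y"
  then have "\<forall>y. g (x - z) y = 0" by (simp add: bilinear_lsub[OF bil])
  then have "x - z = 0" using sp unfolding scalar_product_def nondegenerate_on_def by blast
  then show "x = z" by simp
qed

lemma has_derivative_\<gamma>:
  assumes q: "q \<in> U"
  shows "((\<lambda>q. \<gamma> q u v) has_derivative (\<lambda>h. g (\<theta> q u) (d\<theta> v q h) + g (d\<theta> u q h) (\<theta> q v))) (at q)"
  unfolding \<gamma>_def using bilinear_g
  by (intro bounded_bilinear.FDERIV d\<theta> q) (simp add: bilinear_conv_bounded_bilinear)

lemma frechet_\<gamma>:
  "q \<in> U \<Longrightarrow> frechet_derivative (\<lambda>q. \<gamma> q u v) (at q) h =
     g (\<theta> q u) (d\<theta> v q h) + g (d\<theta> u q h) (\<theta> q v)"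
  using frechet_derivative_at[OF has_derivative_\<gamma>, of q u v] by metis

lemma F_minus: "q \<in> U \<Longrightarrow> F (- x) q = - F x q"
  using linear_neg[OF linear_F] by blast

lemma F_d\<theta>: "q \<in> U \<Longrightarrow> F (d\<theta> w q h) q = - dF (\<theta> q w) q h"
  by (simp add: d\<theta>_def F_minus)

context
  fixes N assumes N: "lc_product br g N"
begin

lemma bilinear_N: "bilinear N" and N_koszul: "2 * g (N x y) z = koszul br g x y z"
  using N by (auto simp: lc_product_def)

text \<open>The constant field \<open>v\<close> has frame components \<open>\<theta> q v\<close>,
  with derivative \<open>d\<theta> v q u\<close>; the connection adds \<open>N\<close>. In the
  coordinate formula the Maurer-Cartan equation reduces all derivatives to
  \<open>d\<theta> v\<close>, and the brackets it produces form the Koszul expression.\<close>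

lemma christoffel_frame:
  assumes q: "q \<in> U"
  shows "christoffel \<gamma> q u v = F (N (\<theta> q u) (\<theta> q v) + d\<theta> v q u) q"
proof -
  let ?z = "F (N (\<theta> q u) (\<theta> q v) + d\<theta> v q u) q"
  have eq: "frechet_derivative (\<lambda>y. \<gamma> y v w) (at q) u + frechet_derivative (\<lambda>y. \<gamma> y u w) (at q) v
        - frechet_derivative (\<lambda>y. \<gamma> y u v) (at q) w = 2 * \<gamma> q ?z w" for w
  proof -
    have swap: "d\<theta> w q u = d\<theta> u q w - br (\<theta> q u) (\<theta> q w)" "d\<theta> u q v = d\<theta> v q u + br (\<theta> q u) (\<theta> q v)"
      "d\<theta> w q v = d\<theta> v q w - br (\<theta> q v) (\<theta> q w)"
      using d\<theta>_skew[OF q, of w u] d\<theta>_skew[OF q, of v u] d\<theta>_skew[OF q, of w v]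
      by (simp_all add: algebra_simps)
    have "2 * \<gamma> q ?z w = koszul br g (\<theta> q u) (\<theta> q v) (\<theta> q w) + 2 * g (d\<theta> v q u) (\<theta> q w)"
      using q by (simp add: \<gamma>_def bilinear_ladd[OF bilinear_g] N_koszul algebra_simps)
    then show ?thesis
      unfolding frechet_\<gamma>[OF q] swap koszul_def bilinear_alt_skew[OF br alt, of "\<theta> q w" "\<theta> q u"]
      by (simp add: bilinear_ladd[OF bilinear_g] bilinear_lsub[OF bilinear_g] bilinear_rsub[OF bilinear_g]
          bilinear_lneg[OF bilinear_g] g_sym[of "\<theta> q v"] g_sym[of "\<theta> q u"])
  qed
  show ?thesis
    unfolding christoffel_def eq
  proof (rule the_equality)
    fix z assume z: "\<forall>w. 2 * \<gamma> q z w = 2 * \<gamma> q ?z w"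
    have "\<theta> q z = \<theta> q ?z"
    proof (rule g_nondegenerate)
      show "g (\<theta> q z) y = g (\<theta> q ?z) y" for y
        using z[rule_format, of "F y q"] q by (simp add: \<gamma>_def)
    qed
    then have "F (\<theta> q z) q = F (\<theta> q ?z) q" by (rule arg_cong)
    then show "z = ?z" using q by simp
  qed simp
qed

text \<open>The component in the frame \<open>F\<close> of the covariant derivative of the constant field \<open>w\<close> in
  direction \<open>v\<close>: in this frame the Levi-Civita connection is \<open>d + N\<close>.\<close>

definition conn :: "'a \<Rightarrow> 'a \<Rightarrow> 'a \<Rightarrow> 'a" where
  "conn v w q = N (\<theta> q v) (\<theta> q w) + d\<theta> w q v"

lemma has_derivative_conn:
  assumes q: "q \<in> U"
  shows "(conn v w has_derivative
     (\<lambda>h. N (\<theta> q v) (d\<theta> w q h) + N (d\<theta> v q h) (\<theta> q w) + dd\<theta> w v q h)) (at q)"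
  unfolding conn_def[abs_def] using bilinear_N
  by (intro has_derivative_add bounded_bilinear.FDERIV d\<theta> dd\<theta> q) (simp add: bilinear_conv_bounded_bilinear)

lemma covariant_derivative_const:
  "covariant_derivative \<gamma> X (\<lambda>_. w) q = christoffel \<gamma> q (X q) w"
  by (simp add: covariant_derivative_def)

lemma covariant_derivative_twice:
  assumes q: "q \<in> U"
  shows "covariant_derivative \<gamma> (\<lambda>_. u) (covariant_derivative \<gamma> (\<lambda>_. v) (\<lambda>_. w)) q =
    F (N (\<theta> q v) (d\<theta> w q u) + N (d\<theta> v q u) (\<theta> q w) + dd\<theta> w v q u + N (\<theta> q u) (conn v w q)) q"
proof -
  have Y: "covariant_derivative \<gamma> (\<lambda>_. v) (\<lambda>_. w) p = F (conn v w p) p" if "p \<in> U" for p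
    unfolding covariant_derivative_const conn_def by (rule christoffel_frame[OF that])
  let ?c' = "\<lambda>h. N (\<theta> q v) (d\<theta> w q h) + N (d\<theta> v q h) (\<theta> q w) + dd\<theta> w v q h"
  have "((\<lambda>p. F (conn v w p) p) has_derivative (\<lambda>h. F (?c' h) q + dF (conn v w q) q h)) (at q)"
    by (rule has_derivative_F[OF has_derivative_ident has_derivative_conn[OF q] q openU q])
  then have "(covariant_derivative \<gamma> (\<lambda>_. v) (\<lambda>_. w) has_derivative
      (\<lambda>h. F (?c' h) q + dF (conn v w q) q h)) (at q)"
    by (rule has_derivative_transform_within_open[OF _ openU q]) (simp add: Y)
  from fun_cong[OF frechet_derivative_at[OF this, symmetric], of u]
  have "covariant_derivative \<gamma> (\<lambda>_. u) (covariant_derivative \<gamma> (\<lambda>_. v) (\<lambda>_. w)) q =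
      F (?c' u) q + dF (conn v w q) q u + christoffel \<gamma> q u (F (conn v w q) q)"
    unfolding covariant_derivative_def[of \<gamma> "\<lambda>_. u"] by (simp add: Y q)
  \<comment> \<open>The derivative of the frame enters here with a minus sign and cancels the one in
    the line before.\<close>
  also have "christoffel \<gamma> q u (F (conn v w q) q) = F (N (\<theta> q u) (conn v w q)) q - dF (conn v w q) q u"
    using q by (simp add: christoffel_frame linear_add[OF linear_F] F_d\<theta>)
  finally show ?thesis using q by (simp add: linear_add[OF linear_F])
qed

text \<open>Constant fields commute, so no bracket of fields contributes. The term
  \<open>N (br _ _)\<close> comes instead from the Maurer-Cartan equation applied to the difference
  of \<open>d\<theta> v q u\<close> and \<open>d\<theta> u q v\<close>.\<close>

lemma riemann_frame:
  assumes q: "q \<in> U"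
  shows "riemann \<gamma> q u v w = F (alg_curvature br N (\<theta> q u) (\<theta> q v) (\<theta> q w)) q"
proof -
  have "field_bracket (\<lambda>_. u) (\<lambda>_. v) = (\<lambda>_. 0)"
    by (simp add: field_bracket_def[abs_def])
  moreover have "christoffel \<gamma> q 0 w = 0"
    using q linear_0[OF linear_\<theta>[OF q]] linear_0[OF linear_d\<theta>[OF q]] linear_0[OF linear_F[OF q]]
    by (simp add: christoffel_frame bilinear_lzero[OF bilinear_N])
  moreover have "N (d\<theta> v q u) (\<theta> q w) = N (d\<theta> u q v) (\<theta> q w) - N (br (\<theta> q u) (\<theta> q v)) (\<theta> q w)"
  proof -
    have "d\<theta> v q u = d\<theta> u q v - br (\<theta> q u) (\<theta> q v)"
      using d\<theta>_skew[OF q, of v u] by (simp add: algebra_simps)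
    then show ?thesis by (simp add: bilinear_lsub[OF bilinear_N])
  qed
  ultimately show ?thesis
    using dd\<theta>_symmetric[OF q, of w v u]
    unfolding riemann_def riemann_op_def covariant_derivative_twice[OF q] alg_curvature_def
    by (simp add: covariant_derivative_const conn_def bilinear_radd[OF bilinear_N] flip: linear_diff[OF linear_F[OF q]])
      (simp add: algebra_simps)
qed

lemma trace_conjugate:
  assumes q: "q \<in> U" and f: "linear f"
  shows "trace_on UNIV (\<lambda>u. F (f (\<theta> q u)) q) = trace_on UNIV f"
proof -
  have "trace_on UNIV (\<lambda>u. F (f (\<theta> q u)) q) = (\<Sum>b\<in>Basis. \<theta> q (F (f (\<theta> q (F b q))) q) \<bullet> b)"
  proof (rule trace_on_frame)
    show "linear (\<lambda>u. F (f (\<theta> q u)) q)"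
      using linear_compose[OF linear_compose[OF linear_\<theta>[OF q] f] linear_F[OF q]] by (simp add: comp_def)
    show "linear (\<lambda>u. \<theta> q u \<bullet> b)" for b
      by (auto intro!: linearI simp: linear_add[OF linear_\<theta>[OF q]] linear_scale[OF linear_\<theta>[OF q]] inner_add_left)
    show "u = (\<Sum>b\<in>Basis. (\<theta> q u \<bullet> b) *\<^sub>R F b q)" for u
      using sum_Basis_linear[OF linear_F[OF q], of "\<theta> q u"] q by simp
  qed auto
  also have "\<dots> = (\<Sum>b\<in>Basis. f b \<bullet> b)" using q by simp
  also have "\<dots> = trace_on UNIV f"
    by (rule trace_on_frame[symmetric])
      (auto simp: f euclidean_representation intro!: linearI inner_add_left)
  finally show ?thesis .
qed

lemma ricci_frame:
  assumes q: "q \<in> U"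
  shows "ricci \<gamma> q v w = trace_on UNIV (\<lambda>x. alg_curvature br N x (\<theta> q v) (\<theta> q w))"
  unfolding ricci_def riemann_frame[OF q]
  by (rule trace_conjugate[OF q])
    (auto intro!: linearI simp: alg_curvature_def bilinear_ladd[OF bilinear_N] bilinear_radd[OF bilinear_N]
      bilinear_lmul[OF bilinear_N] bilinear_rmul[OF bilinear_N] bilinear_ladd[OF br] bilinear_lmul[OF br]
      algebra_simps)

end

text \<open>The metric is constant on left-invariant fields, so its derivative along
  \<open>F z\<close> consists of the two bracket terms, each with a minus sign.\<close>

lemma lie_derivative_frame:
  assumes q: "q \<in> U"
  shows "lie_derivative_metric (F z) \<gamma> q u v =
    - (g (br z (\<theta> q u)) (\<theta> q v) + g (\<theta> q u) (br z (\<theta> q v)))"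
proof -
  have bracket: "\<theta> q (field_bracket (F z) (\<lambda>_. w) q) = d\<theta> w q (F z q) + br z (\<theta> q w)" for w
  proof -
    have "\<theta> q (field_bracket (F z) (\<lambda>_. w) q) = d\<theta> (F z q) q w"
      using q by (simp add: field_bracket_def d\<theta>_def dF_def linear_neg[OF linear_\<theta>])
    then show ?thesis using d\<theta>_skew[OF q, of w "F z q"] q by (simp add: algebra_simps)
  qed
  show ?thesis
    unfolding lie_derivative_metric_def frechet_\<gamma>[OF q] unfolding \<gamma>_def bracket
    by (simp add: bilinear_ladd[OF bilinear_g] bilinear_radd[OF bilinear_g])
qed

end

section \<open>Left-invariant metrics on Lie groups\<close>

lemma smooth_on_differentiable:
  "smooth_on S f \<Longrightarrow> x \<in> S \<Longrightarrow> f differentiable (at x)"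
  using Ck_on.simps(2)[of 0 S f] unfolding smooth_on_def by blast

lemma smooth_on_frechet_differentiable:
  assumes "smooth_on S f" "x \<in> S"
  shows "(\<lambda>x. frechet_derivative f (at x) v) differentiable (at x)"
proof -
  have "Ck_on (Suc (Suc 0)) S f" using assms unfolding smooth_on_def by blast
  then show ?thesis using assms(2) by simp
qed

lemma smooth_atlas_chart:
  assumes "smooth_atlas A" "c \<in> A"
  shows "open (snd c ` fst c)" "p \<in> fst c \<Longrightarrow> chart_inv c (snd c p) = p"
  using assms unfolding smooth_atlas_def homeomorphism_def by blast+

text \<open>Left translation by \<open>a\<close> is multiplication on a slice with fixed first
  factor, read in the product of a chart around \<open>a\<close> and the chart
  \<open>c\<close>.\<close>

lemma left_translation_differentiable:
  fixes A :: "('p::{t2_space,second_countable_topology}, 'a::euclidean_space) chart set"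
  assumes G: "lie_group G A" and c: "c \<in> A" "p \<in> fst c" and d: "d \<in> A" "a \<otimes>\<^bsub>G\<^esub> p \<in> fst d"
  shows "(snd d \<circ> (\<lambda>q. a \<otimes>\<^bsub>G\<^esub> q) \<circ> chart_inv c) differentiable (at (snd c p))"
proof -
  have A: "smooth_atlas A" and mult: "smooth_map (product_atlas A A) A (\<lambda>(p, q). p \<otimes>\<^bsub>G\<^esub> q)"
    using G by (auto simp: lie_group_def)
  obtain b where b: "b \<in> A" "a \<in> fst b" using A unfolding smooth_atlas_def by blast
  note inv = smooth_atlas_chart(2)[OF A]
  define k where "k = (fst b \<times> fst c, map_prod (snd b) (snd c))"
  have k: "k \<in> product_atlas A A" unfolding product_atlas_def k_def using b c by blast
  \<comment> \<open>The inverse of the product chart is a choice on the product set; injectivity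
    identifies it with the componentwise inverse along the slice.\<close>
  have inj: "inj_on (snd k) (fst k)"
    by (rule inj_on_inverseI[where g = "map_prod (chart_inv b) (chart_inv c)"])
      (use b(1) c(1) in \<open>auto simp: k_def inv\<close>)
  have k_inv: "chart_inv k (snd b a, snd c r) = (a, r)" if "r \<in> fst c" for r
    unfolding chart_inv_def using inv_into_f_f[OF inj, of "(a, r)"] that b by (simp add: k_def)
  have "smooth_on (snd k ` (fst k \<inter> (\<lambda>(p, q). p \<otimes>\<^bsub>G\<^esub> q) -` fst d))
      (snd d \<circ> (\<lambda>(p, q). p \<otimes>\<^bsub>G\<^esub> q) \<circ> chart_inv k)"
    using mult k d unfolding smooth_map_def by blast
  moreover have "(snd b a, snd c p) \<in> snd k ` (fst k \<inter> (\<lambda>(p, q). p \<otimes>\<^bsub>G\<^esub> q) -` fst d)"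
    using b c d by (auto simp: k_def intro!: image_eqI[of _ _ "(a, p)"])
  ultimately obtain D where D: "((snd d \<circ> (\<lambda>(p, q). p \<otimes>\<^bsub>G\<^esub> q) \<circ> chart_inv k) has_derivative D)
      (at (snd b a, snd c p))"
    using smooth_on_differentiable unfolding differentiable_def by blast
  have "((\<lambda>x. (snd b a, x)) has_derivative (\<lambda>h. (0, h))) (at (snd c p))"
    by (intro has_derivative_Pair has_derivative_const has_derivative_ident)
  from has_derivative_compose[OF this D]
  have "((\<lambda>x. (snd d \<circ> (\<lambda>(p, q). p \<otimes>\<^bsub>G\<^esub> q) \<circ> chart_inv k) (snd b a, x)) has_derivative (\<lambda>h. D (0, h)))
      (at (snd c p))" .
  then have "((snd d \<circ> (\<lambda>q. a \<otimes>\<^bsub>G\<^esub> q) \<circ> chart_inv c) has_derivative (\<lambda>h. D (0, h))) (at (snd c p))"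
    by (rule has_derivative_transform_within_open[OF _ smooth_atlas_chart(1)[OF A c(1)]])
      (use c(2) in \<open>auto simp: k_inv inv[OF c(1)]\<close>)
  then show ?thesis by (auto simp: differentiable_def)
qed

text \<open>Translation by \<open>r\<close> times the inverse of \<open>p\<close> carries the value
  at \<open>p\<close> linearly to the value at \<open>r\<close>. This makes the frame injective at
  every point, since \<open>\<Lambda>\<close> is injective.\<close>

lemma left_invariant_field_eq_0:
  fixes A :: "('p::{t2_space,second_countable_topology}, 'a::euclidean_space) chart set"
  assumes G: "lie_group G A" and X: "X \<in> left_invariant_fields G A"
    and c: "c \<in> A" "p \<in> fst c" "X c p = 0"
  shows "X d r = 0"
proof (cases "d \<in> A \<and> r \<in> fst d")
  case False
  then show ?thesis using X unfolding left_invariant_fields_def smooth_vector_field_def by blast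
next
  case True
  have grp: "group G" "carrier G = UNIV" using G by (auto simp: lie_group_def)
  define a where "a = r \<otimes>\<^bsub>G\<^esub> inv\<^bsub>G\<^esub> p"
  interpret G: group G by (rule grp)
  have ap: "a \<otimes>\<^bsub>G\<^esub> p = r" by (simp add: a_def G.m_assoc grp)
  have dr: "d \<in> A" "a \<otimes>\<^bsub>G\<^esub> p \<in> fst d" using True ap by simp_all
  have "X d (a \<otimes>\<^bsub>G\<^esub> p) = tangent_map c d (\<lambda>q. a \<otimes>\<^bsub>G\<^esub> q) p (X c p)"
    using X c dr unfolding left_invariant_fields_def by blast
  also have "\<dots> = 0"
    unfolding tangent_map_def c(3)
    by (rule linear_0[OF linear_frechet_derivative[OF left_translation_differentiable[OF G c(1,2) dr]]])
  finally show ?thesis by (simp add: ap)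
qed

lemma moving_frame_of_group:
  fixes A :: "('p::{t2_space,second_countable_topology}, 'a::euclidean_space) chart set"
  assumes G: "lie_group G A" and iso: "lie_algebra_of_group_iso G A br \<Lambda>"
    and L: "lie_algebra br" and g: "scalar_product g" and c: "c \<in> A"
  shows "moving_frame (snd c ` fst c) (\<lambda>x. in_chart c (\<Lambda> x)) br g"
proof (rule moving_frame.intro)
  have A: "smooth_atlas A" using G by (simp add: lie_group_def)
  have lin: "linear (\<lambda>x. \<Lambda> x c p)" for c p
    using iso unfolding lie_algebra_of_group_iso_def by blast
  have bij: "bij_betw \<Lambda> UNIV (left_invariant_fields G A)"
    using iso unfolding lie_algebra_of_group_iso_def by blast
  then have \<Lambda>: "\<Lambda> x \<in> left_invariant_fields G A" for x
    unfolding bij_betw_def by blast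
  then have smooth: "smooth_on (snd c ` fst c) (in_chart c (\<Lambda> x))" for x
    using c unfolding left_invariant_fields_def smooth_vector_field_def by blast
  show "open (snd c ` fst c)" by (rule smooth_atlas_chart[OF A c])
  show "linear (\<lambda>x. in_chart c (\<Lambda> x) q)" if "q \<in> snd c ` fst c" for q
    unfolding in_chart_def by (rule lin)
  show "inj (\<lambda>x. in_chart c (\<Lambda> x) q)" if q: "q \<in> snd c ` fst c" for q
  proof -
    obtain p where p: "p \<in> fst c" "q = snd c p" using q by blast
    have "x = 0" if "\<Lambda> x c p = 0" for x
    proof -
      have "\<Lambda> x d r = \<Lambda> 0 d r" for d r
        using left_invariant_field_eq_0[OF G \<Lambda> c p(1) that] linear_0[OF lin] by simp
      then have "\<Lambda> x = \<Lambda> 0" by blast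
      then show ?thesis using bij unfolding bij_betw_def inj_on_def by blast
    qed
    then show ?thesis
      by (simp add: in_chart_def linear_injective_0[OF lin] p smooth_atlas_chart(2)[OF A c])
  qed
  show "in_chart c (\<Lambda> x) differentiable (at q)" if "q \<in> snd c ` fst c" for q x
    by (rule smooth_on_differentiable[OF smooth that])
  show "(\<lambda>q. frechet_derivative (in_chart c (\<Lambda> x)) (at q) u) differentiable (at q)"
    if "q \<in> snd c ` fst c" for q x u
    by (rule smooth_on_frechet_differentiable[OF smooth that])
  show "in_chart c (\<Lambda> (br x y)) q = field_bracket (in_chart c (\<Lambda> x)) (in_chart c (\<Lambda> y)) q"
    if "q \<in> snd c ` fst c" for q x y
    using iso c that unfolding lie_algebra_of_group_iso_def by blast
qed (use L g in \<open>simp_all add: lie_algebra_def\<close>)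

lemma metric_in_chart:
  fixes \<Lambda> :: "'a::euclidean_space \<Rightarrow> ('p, 'a) field"
  assumes "moving_frame U (\<lambda>x. in_chart c (\<Lambda> x)) br g"
  shows "in_chart c (left_invariant_metric \<Lambda> g) = moving_frame.\<gamma> (\<lambda>x. in_chart c (\<Lambda> x)) g"
  by (intro ext) (simp add: in_chart_def left_invariant_metric_def moving_frame.\<gamma>_def[OF assms]
      moving_frame.\<theta>_def[OF assms])

section \<open>The soliton and curvature statements on the group\<close>

context soliton_algebra
begin

context
  fixes A :: "('p::{t2_space,second_countable_topology}, 'a) chart set" and G \<Lambda>
  assumes L: "lie_algebra br" and G: "lie_group G A" and iso: "lie_algebra_of_group_iso G A br \<Lambda>"
begin

lemma ricci_soliton_metric: "ricci_soliton A (left_invariant_metric \<Lambda> g)"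
proof -
  obtain N where N: "lc_product br g N" using lc_product_exists[OF br dim sp dual] by blast
  let ?z = "(- 2 * t * \<epsilon>) *\<^sub>R v2"
  have "\<Lambda> ?z \<in> left_invariant_fields G A"
    using iso unfolding lie_algebra_of_group_iso_def bij_betw_def by blast
  then have "smooth_vector_field A (\<Lambda> ?z)" by (simp add: left_invariant_fields_def)
  moreover have "ricci (in_chart c (left_invariant_metric \<Lambda> g)) q u v
        + 1/2 * lie_derivative_metric (in_chart c (\<Lambda> ?z)) (in_chart c (left_invariant_metric \<Lambda> g)) q u v
      = 0 * in_chart c (left_invariant_metric \<Lambda> g) q u v"
    if c: "c \<in> A" and q: "q \<in> snd c ` fst c" for c q u v
  proof -
    interpret M: moving_frame "snd c ` fst c" "\<lambda>x. in_chart c (\<Lambda> x)" br g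
      by (rule moving_frame_of_group[OF G iso L sp c])
    show ?thesis
      unfolding metric_in_chart[OF M.moving_frame_axioms] M.ricci_frame[OF N q]
        M.lie_derivative_frame[OF q] soliton_equation[OF N]
      by (simp add: field_simps)
  qed
  ultimately show ?thesis unfolding ricci_soliton_def by blast
qed

lemma not_constant_curvature_metric: "\<not> constant_curvature A (left_invariant_metric \<Lambda> g)"
proof
  assume "constant_curvature A (left_invariant_metric \<Lambda> g)"
  then obtain k where k: "\<And>c x u v. c \<in> A \<Longrightarrow> x \<in> snd c ` fst c \<Longrightarrow>
        (let \<gamma>x = in_chart c (left_invariant_metric \<Lambda> g) x; Q = \<gamma>x u u * \<gamma>x v v - (\<gamma>x u v)\<^sup>2
        in Q \<noteq> 0 \<longrightarrow> \<gamma>x (riemann (in_chart c (left_invariant_metric \<Lambda> g)) x u v v) u / Q = k)"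
    unfolding constant_curvature_def by blast
  obtain N where N: "lc_product br g N" using lc_product_exists[OF br dim sp dual] by blast
  obtain c p where c: "c \<in> A" "p \<in> fst c"
    using G unfolding lie_group_def smooth_atlas_def by blast
  then have q: "snd c p \<in> snd c ` fst c" by blast
  interpret M: moving_frame "snd c ` fst c" "\<lambda>x. in_chart c (\<Lambda> x)" br g
    by (rule moving_frame_of_group[OF G iso L sp c(1)])
  \<comment> \<open>Frame fields take arbitrary Lie algebra elements as components at the chosen
    point, so the condition becomes purely algebraic.\<close>
  have sec: "g (alg_curvature br N x y y) x / (g x x * g y y - (g x y)\<^sup>2) = k"
    if "g x x * g y y - (g x y)\<^sup>2 \<noteq> 0" for x y
    using k[OF c(1) q, of "in_chart c (\<Lambda> x) (snd c p)" "in_chart c (\<Lambda> y) (snd c p)"] that q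
    unfolding metric_in_chart[OF M.moving_frame_axioms]
    by (simp add: Let_def M.riemann_frame[OF N q] M.\<gamma>_def)
  have "k = 0"
    using sec[of v1 v2] by (simp add: sectional_curvatures[OF N] g_table eps_square)
  \<comment> \<open>The plane of \<open>v1\<close> and \<open>v3\<close> is Lorentzian, so the
    denominator is \<open>- 1\<close>.\<close>
  moreover have "k = - (2 * t * t * \<epsilon>)"
    using sec[of v1 v3] by (simp add: sectional_curvatures[OF N] g_table eps_square)
  ultimately show False using t_pos eps_cases by auto
qed

end

end

theorem theorem1p3:
  fixes br :: "'a::euclidean_space \<Rightarrow> 'a \<Rightarrow> 'a"
    and H :: "'a \<Rightarrow> 'a \<Rightarrow> 'a \<Rightarrow> real"
    and g :: "'a \<Rightarrow> 'a \<Rightarrow> real"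
  assumes "lie_algebra br"
    and "DIM('a) = 3"
    and "\<not> unimodular br"
    and "generalized_einstein br H g (\<lambda>_. 0)"
  shows "(\<forall>x y z. H x y z = 0) \<and>
    indefinite_on (unimodular_kernel br) g \<and>
    nondegenerate_on (unimodular_kernel br) g \<and>
    lie_isomorphic br (semidirect_bracket (vector [vector [1, 1], vector [-1, 1]] :: real^2^2)) \<and>
    (\<exists>v\<^sub>1 v\<^sub>2 v\<^sub>3 \<theta>.
       independent {v\<^sub>1, v\<^sub>2, v\<^sub>3} \<and> span {v\<^sub>1, v\<^sub>2, v\<^sub>3} = UNIV \<and>
       v\<^sub>1 \<in> unimodular_kernel br \<and> v\<^sub>3 \<in> unimodular_kernel br \<and>
       g v\<^sub>1 v\<^sub>2 = 0 \<and> g v\<^sub>1 v\<^sub>3 = 0 \<and> g v\<^sub>2 v\<^sub>3 = 0 \<and>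
       \<bar>g v\<^sub>1 v\<^sub>1\<bar> = 1 \<and> g v\<^sub>1 v\<^sub>1 = g v\<^sub>2 v\<^sub>2 \<and> g v\<^sub>2 v\<^sub>2 = - g v\<^sub>3 v\<^sub>3 \<and>
       \<theta> > 0 \<and>
       br v\<^sub>1 v\<^sub>3 = 0 \<and>
       br v\<^sub>2 v\<^sub>1 = \<theta> *\<^sub>R v\<^sub>1 - \<theta> *\<^sub>R v\<^sub>3 \<and>
       br v\<^sub>2 v\<^sub>3 = \<theta> *\<^sub>R v\<^sub>1 + \<theta> *\<^sub>R v\<^sub>3) \<and>
    (\<forall>(G :: 'p::{t2_space,second_countable_topology} monoid) A \<Lambda>.
       lie_group G A \<and> lie_algebra_of_group_iso G A br \<Lambda> \<longrightarrow>
         ricci_soliton A (left_invariant_metric \<Lambda> g) \<and>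
         \<not> constant_curvature A (left_invariant_metric \<Lambda> g))"
proof -
  obtain v1 v2 v3 t \<epsilon> where frame: "soliton_frame br g v1 v2 v3 t \<epsilon>" and H: "\<And>x y z. H x y z = 0"
    using divergence_free_einstein_structure[OF assms] by blast
  interpret soliton_algebra br g v1 v2 v3 t \<epsilon>
    using assms frame by unfold_locales
      (auto simp: lie_algebra_def generalized_einstein_def)
  have kernel: "v1 \<in> unimodular_kernel br" "v3 \<in> unimodular_kernel br"
    by (simp_all add: unimodular_kernel_def trace_ad_frame)
  show ?thesis
  proof (intro conjI allI impI)
    show "\<exists>v\<^sub>1 v\<^sub>2 v\<^sub>3 \<theta>.
       independent {v\<^sub>1, v\<^sub>2, v\<^sub>3} \<and> span {v\<^sub>1, v\<^sub>2, v\<^sub>3} = UNIV \<and>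
       v\<^sub>1 \<in> unimodular_kernel br \<and> v\<^sub>3 \<in> unimodular_kernel br \<and>
       g v\<^sub>1 v\<^sub>2 = 0 \<and> g v\<^sub>1 v\<^sub>3 = 0 \<and> g v\<^sub>2 v\<^sub>3 = 0 \<and>
       \<bar>g v\<^sub>1 v\<^sub>1\<bar> = 1 \<and> g v\<^sub>1 v\<^sub>1 = g v\<^sub>2 v\<^sub>2 \<and> g v\<^sub>2 v\<^sub>2 = - g v\<^sub>3 v\<^sub>3 \<and>
       \<theta> > 0 \<and>
       br v\<^sub>1 v\<^sub>3 = 0 \<and>
       br v\<^sub>2 v\<^sub>1 = \<theta> *\<^sub>R v\<^sub>1 - \<theta> *\<^sub>R v\<^sub>3 \<and>
       br v\<^sub>2 v\<^sub>3 = \<theta> *\<^sub>R v\<^sub>1 + \<theta> *\<^sub>R v\<^sub>3"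
      using frame basis kernel unfolding soliton_frame_def
      by (intro exI[of _ v1] exI[of _ v2] exI[of _ v3] exI[of _ t]) simp
  qed (use H indefinite nondegenerate isomorphic assms(1)
      ricci_soliton_metric not_constant_curvature_metric in blast)+
qed

end
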